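(* The radical $\mathfrak{I}$ of the bilinear form $(,)$ on the free algebra ${}'\mathfrak{f}$ is generated, as a two-sided ideal, by the elements $$S_{ij}=\sum_{p+p'=1-2\frac{i\cdot j}{i\cdot i}}(-1)^p\,t_i^{-p\left(p'-2\frac{\langle i,j\rangle}{i\cdot i}+2\frac{\langle j,i\rangle}{i\cdot i}\right)}\theta_i^{(p)}\theta_j\theta_i^{(p')},\qquad i\neq j\in I,$$ where $p,p'$ range over non-negative integers.
   Context: $I$ is a finite set and $\Omega=(\Omega_{ij})_{i,j\in I}$ an integer matrix such that (a) $\Omega_{ii}\in\mathbb{Z}_{>0}$ and $\Omega_{ij}\in\mathbb{Z}_{\le0}$ for $i\neq j$; (b) $\frac{\Omega_{ij}+\Omega_{ji}}{\Omega_{ii}}\in\mathbb{Z}_{\le0}$ for $i\ne j$; (c) $\gcd_i(\Omega_{ii})=1$. Bilinear forms on $\mathbb{Z}^I$: $\langle i,j\rangle=\Omega_{ij}$, $[i,j]=2\delta_{ij}\Omega_{ii}-\Omega_{ij}$, $i\cdot j=\langle i,j\rangle+\langle j,i\rangle$. For indeterminates $v,t$: $v_i=v^{i\cdot i/2}$, $t_i=t^{i\cdot i/2}$ (so the powers of $t_i$ above are integral powers of $t$), $[n]_{v,t}=\frac{(vt)^n-(vt^{-1})^{-n}}{vt-(vt^{-1})^{-1}}$, $[n]^!_{v,t}=\prod_{k=1}^n[k]_{v,t}$, and $[n]^!_{v_i,t_i}$ is obtained by substituting $v_i,t_i$. ${}'\mathfrak{f}$ is the free unital associative $\mathbb{Q}(v,t)$-algebra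 on $\theta_i$ ($i\in I$), $\mathbb{N}^I$-graded with $|\theta_i|=i$; $\theta_i^{(n)}=\theta_i^n/[n]^!_{v_i,t_i}$. ${}'\mathfrak{f}\otimes{}'\mathfrak{f}$ has multiplication $(x_1\otimes x_2)(y_1\otimes y_2)=v^{-|y_1|\cdot|x_2|}t^{\langle|y_1|,|x_2|\rangle-\langle|x_2|,|y_1|\rangle}x_1y_1\otimes x_2y_2$ on homogeneous elements, and $r:{}'\mathfrak{f}\to{}'\mathfrak{f}\otimes{}'\mathfrak{f}$ is the algebra homomorphism with $r(\theta_i)=\theta_i\otimes1+1\otimes\theta_i$. $(,)$ is the unique (symmetric) $\mathbb{Q}(v,t)$-valued bilinear form on ${}'\mathfrak{f}$ with $(1,1)=1$, $(\theta_i,\theta_j)=\delta_{ij}(1-v_i^{-2})^{-1}$, $(x,y'y'')=(r(x),y'\otimes y'')$, $(x'x'',y)=(x'\otimes x'',r(y))$, where $(x_1\otimes x_2,y_1\otimes y_2)=t^{2[|x_1|,|x_2|]}(x_1,y_1)(x_2,y_2)$ for homogeneous elements. *)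

theory Defs
  imports
    "HOL-Library.Poly_Mapping"
    "HOL-Library.Nonpos_Ints"
    "HOL-Computational_Algebra.Computational_Algebra"
begin

section \<open>The field of rational functions in two indeterminates\<close>

type_synonym qvt = "rat poly poly fract"

definition vv :: qvt where "vv = to_fract [:[:0, 1:]:]"

definition tt :: qvt where "tt = to_fract [:0, 1:]"


section \<open>Bilinear forms on the lattice\<close>

definition bilin :: "('i::finite \<Rightarrow> 'i \<Rightarrow> int) \<Rightarrow> ('i \<Rightarrow> int) \<Rightarrow> ('i \<Rightarrow> int) \<Rightarrow> int" where
  "bilin M x y = (\<Sum>i\<in>UNIV. \<Sum>j\<in>UNIV. x i * y j * M i j)"

definition ang :: "('i::finite \<Rightarrow> 'i \<Rightarrow> int) \<Rightarrow> ('i \<Rightarrow> int) \<Rightarrow> ('i \<Rightarrow> int) \<Rightarrow> int" where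
  "ang \<Omega> = bilin \<Omega>"

definition brk :: "('i::finite \<Rightarrow> 'i \<Rightarrow> int) \<Rightarrow> ('i \<Rightarrow> int) \<Rightarrow> ('i \<Rightarrow> int) \<Rightarrow> int" where
  "brk \<Omega> = bilin (\<lambda>i j. 2 * of_bool (i = j) * \<Omega> i i - \<Omega> i j)"

definition dot :: "('i::finite \<Rightarrow> 'i \<Rightarrow> int) \<Rightarrow> ('i \<Rightarrow> int) \<Rightarrow> ('i \<Rightarrow> int) \<Rightarrow> int" where
  "dot \<Omega> x y = ang \<Omega> x y + ang \<Omega> y x"

definition simple :: "'i \<Rightarrow> 'i \<Rightarrow> int" where
  "simple i = (\<lambda>k. of_bool (k = i))"

text \<open>
  The halves below are exact: \<open>dot \<Omega> (simple i) (simple i) = 2 * \<Omega> i i\<close>.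
\<close>

definition v_at :: "('i::finite \<Rightarrow> 'i \<Rightarrow> int) \<Rightarrow> 'i \<Rightarrow> qvt" where
  "v_at \<Omega> i = vv powi (dot \<Omega> (simple i) (simple i) div 2)"

definition t_at :: "('i::finite \<Rightarrow> 'i \<Rightarrow> int) \<Rightarrow> 'i \<Rightarrow> qvt" where
  "t_at \<Omega> i = tt powi (dot \<Omega> (simple i) (simple i) div 2)"

definition qint :: "qvt \<Rightarrow> qvt \<Rightarrow> nat \<Rightarrow> qvt" where
  "qint a b n = ((a * b) powi int n - (a * inverse b) powi (- int n)) /
                (a * b - inverse (a * inverse b))"

definition qfact :: "qvt \<Rightarrow> qvt \<Rightarrow> nat \<Rightarrow> qvt" where
  "qfact a b n = (\<Prod>k=1..n. qint a b k)"


section \<open>The free algebra\<close>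

text \<open>
  The free monoid is a separate type, written additively, because \<open>Poly_Mapping\<close>
  provides the monoid algebra (convolution product) over \<open>monoid_add\<close>.
  Hence \<open>'i falg\<close>, with its library ring structure, is the free unital associative
  algebra, the words being a basis.
\<close>

datatype 'i fmon = FMon (letters: "'i list")

instantiation fmon :: (type) monoid_add
begin

definition zero_fmon :: "'a fmon" where "0 = FMon []"

definition plus_fmon :: "'a fmon \<Rightarrow> 'a fmon \<Rightarrow> 'a fmon" where
  "x + y = FMon (letters x @ letters y)"

instance
  by standard (simp_all add: zero_fmon_def plus_fmon_def)

end

type_synonym 'i falg = "'i fmon \<Rightarrow>\<^sub>0 qvt"

definition scal :: "qvt \<Rightarrow> ('b \<Rightarrow>\<^sub>0 qvt) \<Rightarrow> ('b \<Rightarrow>\<^sub>0 qvt)" where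
  "scal c = Poly_Mapping.map ((*) c)"

definition theta :: "'i \<Rightarrow> 'i falg" where
  "theta i = Poly_Mapping.single (FMon [i]) 1"

definition weight :: "'i fmon \<Rightarrow> 'i \<Rightarrow> int" where
  "weight w = (\<lambda>i. int (count_list (letters w) i))"

definition divpow :: "('i::finite \<Rightarrow> 'i \<Rightarrow> int) \<Rightarrow> 'i \<Rightarrow> nat \<Rightarrow> 'i falg" where
  "divpow \<Omega> i n = scal (inverse (qfact (v_at \<Omega> i) (t_at \<Omega> i) n)) (theta i ^ n)"


section \<open>The twisted tensor square and the coproduct\<close>

text \<open>
  The tensor square is the vector space with basis the pairs of words,
  \<open>(a, b)\<close> standing for the tensor product of \<open>a\<close> and \<open>b\<close>.
\<close>

type_synonym 'i falg2 = "('i fmon \<times> 'i fmon) \<Rightarrow>\<^sub>0 qvt"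

definition linext :: "('a \<Rightarrow> ('b \<Rightarrow>\<^sub>0 qvt)) \<Rightarrow> ('a \<Rightarrow>\<^sub>0 qvt) \<Rightarrow> ('b \<Rightarrow>\<^sub>0 qvt)" where
  "linext f x = (\<Sum>a\<in>Poly_Mapping.keys x. scal (Poly_Mapping.lookup x a) (f a))"

definition tens :: "'i falg \<Rightarrow> 'i falg \<Rightarrow> 'i falg2" where
  "tens x y = linext (\<lambda>a. linext (\<lambda>b. Poly_Mapping.single (a, b) 1) y) x"

definition tmult :: "('i::finite \<Rightarrow> 'i \<Rightarrow> int) \<Rightarrow> 'i falg2 \<Rightarrow> 'i falg2 \<Rightarrow> 'i falg2" where
  "tmult \<Omega> X Y =
     linext (\<lambda>(x1, x2). linext (\<lambda>(y1, y2).
       Poly_Mapping.single (x1 + y1, x2 + y2)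
         (vv powi (- dot \<Omega> (weight y1) (weight x2)) *
          tt powi (ang \<Omega> (weight y1) (weight x2) - ang \<Omega> (weight x2) (weight y1)))) Y) X"

primrec coprod_word :: "('i::finite \<Rightarrow> 'i \<Rightarrow> int) \<Rightarrow> 'i list \<Rightarrow> 'i falg2" where
  "coprod_word \<Omega> [] = tens 1 1"
| "coprod_word \<Omega> (i # w) =
     tmult \<Omega> (tens (theta i) 1 + tens 1 (theta i)) (coprod_word \<Omega> w)"

text \<open>
  The algebra homomorphism determined by its values on the generators;
  see \<open>coprod_theta\<close>, \<open>coprod_one\<close>, \<open>coprod_mult\<close> and \<open>coprod_add\<close>, \<open>coprod_scal\<close>.
\<close>

definition coprod :: "('i::finite \<Rightarrow> 'i \<Rightarrow> int) \<Rightarrow> 'i falg \<Rightarrow> 'i falg2" where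
  "coprod \<Omega> = linext (\<lambda>w. coprod_word \<Omega> (letters w))"

lemma poly_mapping_induct [case_names zero single sum]:
  fixes x :: "'a \<Rightarrow>\<^sub>0 'b::monoid_add"
  assumes zero: "P 0"
    and single: "\<And>a c. P (Poly_Mapping.single a c)"
    and sum: "\<And>x y. P x \<Longrightarrow> P y \<Longrightarrow> P (x + y)"
  shows "P x"
proof (induction x rule: update_induct)
  case const
  show ?case by (rule zero)
next
  case (update f a b)
  have "Poly_Mapping.update a b f = f + Poly_Mapping.single a b"
    using update by (intro poly_mapping_eqI)
      (auto simp: lookup_update lookup_add lookup_single when_def in_keys_iff)
  with update single sum show ?case by simp
qed

lemma lookup_scal [simp]: "Poly_Mapping.lookup (scal c x) a = c * Poly_Mapping.lookup x a"
  by (simp add: scal_def Poly_Mapping.map.rep_eq when_def)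

lemma scal_simps [simp]:
  "scal 0 x = 0" "scal c 0 = 0" "scal 1 x = x"
  "scal c (x + y) = scal c x + scal c y"
  "scal c (scal d x) = scal (c * d) x"
  "scal c (Poly_Mapping.single a d) = Poly_Mapping.single a (c * d)"
  by (auto intro!: poly_mapping_eqI simp: lookup_add algebra_simps lookup_single when_def)

lemma scal_add_left: "scal (c + d) x = scal c x + scal d x"
  by (auto intro!: poly_mapping_eqI simp: lookup_add algebra_simps)

lemma linext_superset:
  assumes "finite A" "Poly_Mapping.keys x \<subseteq> A"
  shows "linext f x = (\<Sum>a\<in>A. scal (Poly_Mapping.lookup x a) (f a))"
  unfolding linext_def
  by (rule sum.mono_neutral_left) (use assms in \<open>auto simp: in_keys_iff\<close>)

lemma linext_add [simp]: "linext f (x + y) = linext f x + linext f y"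
proof -
  let ?A = "Poly_Mapping.keys x \<union> Poly_Mapping.keys y"
  have "Poly_Mapping.keys (x + y) \<subseteq> ?A" by (rule Poly_Mapping.keys_add)
  then show ?thesis
    by (simp add: linext_superset[of ?A] lookup_add scal_add_left sum.distrib)
qed

lemma linext_single [simp]: "linext f (Poly_Mapping.single a c) = scal c (f a)"
  by (cases "c = 0") (simp_all add: linext_def)

lemma linext_zero [simp]: "linext f 0 = 0"
  by (simp add: linext_def)

lemma linext_scal [simp]: "linext f (scal c x) = scal c (linext f x)"
  by (induction x rule: poly_mapping_induct) simp_all

lemma linext_fun_add: "linext (\<lambda>a. f a + g a) x = linext f x + linext g x"
  by (simp add: linext_def sum.distrib)

lemma linext_fun_scal: "linext (\<lambda>a. scal c (f a)) x = scal c (linext f x)"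
  by (induction x rule: poly_mapping_induct) (simp_all add: mult.commute)

lemma tmult_add_left [simp]: "tmult \<Omega> (X + X') Y = tmult \<Omega> X Y + tmult \<Omega> X' Y"
  by (simp add: tmult_def)

lemma tmult_scal_left [simp]: "tmult \<Omega> (scal c X) Y = scal c (tmult \<Omega> X Y)"
  by (simp add: tmult_def)

lemma tmult_add_right [simp]: "tmult \<Omega> X (Y + Y') = tmult \<Omega> X Y + tmult \<Omega> X Y'"
  by (simp add: tmult_def case_prod_unfold linext_fun_add)

lemma tmult_scal_right [simp]: "tmult \<Omega> X (scal c Y) = scal c (tmult \<Omega> X Y)"
  by (simp add: tmult_def case_prod_unfold linext_fun_scal)

lemma weight_simps [simp]: "weight 0 = (\<lambda>_. 0)" "weight (a + b) = (\<lambda>i. weight a i + weight b i)"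
  by (auto simp: weight_def zero_fmon_def plus_fmon_def)

lemma bilin_simps [simp]:
  "bilin M (\<lambda>_. 0) y = 0" "bilin M x (\<lambda>_. 0) = 0"
  "bilin M (\<lambda>i. x i + x' i) y = bilin M x y + bilin M x' y"
  "bilin M x (\<lambda>i. y i + y' i) = bilin M x y + bilin M x y'"
  by (simp_all add: bilin_def algebra_simps sum.distrib)

lemma tmult_single:
  "tmult \<Omega> (Poly_Mapping.single (x1, x2) c) (Poly_Mapping.single (y1, y2) d) =
   Poly_Mapping.single (x1 + y1, x2 + y2)
     (c * d * (vv powi (- dot \<Omega> (weight y1) (weight x2)) *
      tt powi (ang \<Omega> (weight y1) (weight x2) - ang \<Omega> (weight x2) (weight y1))))"
  by (simp add: tmult_def mult_ac)

lemma vv_tt_nonzero [simp]: "vv \<noteq> 0" "tt \<noteq> 0"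
  by (simp_all add: vv_def tt_def)

lemma tmult_zero [simp]: "tmult \<Omega> 0 Y = 0" "tmult \<Omega> X 0 = 0"
  using tmult_scal_left[of \<Omega> 0 0 Y] tmult_scal_right[of \<Omega> X 0 0] by simp_all

lemma tmult_assoc: "tmult \<Omega> (tmult \<Omega> X Y) Z = tmult \<Omega> X (tmult \<Omega> Y Z)"
proof (induction X rule: poly_mapping_induct)
  case (single p c)
  show ?case
  proof (induction Y rule: poly_mapping_induct)
    case (single q d)
    show ?case
    proof (induction Z rule: poly_mapping_induct)
      case (single r e)
      obtain p1 p2 q1 q2 r1 r2 where "p = (p1, p2)" "q = (q1, q2)" "r = (r1, r2)"
        by (metis surj_pair)
      then show ?case
        by (simp add: tmult_single dot_def ang_def add.assoc)
           (simp add: power_int_add power_int_diff power_int_minus field_simps)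
    qed simp_all
  qed simp_all
qed simp_all

lemma tens_one_one: "tens 1 1 = Poly_Mapping.single (0, 0) 1"
  by (simp add: tens_def flip: single_one)

lemma tmult_one: "tmult \<Omega> (tens 1 1) Y = Y"
  by (induction Y rule: poly_mapping_induct)
     (auto simp: tens_one_one tmult_single dot_def ang_def)

lemma tmult_one_right: "tmult \<Omega> X (tens 1 1) = X"
  by (induction X rule: poly_mapping_induct)
     (auto simp: tens_one_one tmult_single dot_def ang_def)

lemma coprod_word_append:
  "coprod_word \<Omega> (u @ w) = tmult \<Omega> (coprod_word \<Omega> u) (coprod_word \<Omega> w)"
  by (induction u) (simp_all add: tmult_one tmult_assoc flip: tmult_add_left)

lemma coprod_add: "coprod \<Omega> (x + y) = coprod \<Omega> x + coprod \<Omega> y"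
  by (simp add: coprod_def)

lemma coprod_scal: "coprod \<Omega> (scal c x) = scal c (coprod \<Omega> x)"
  by (simp add: coprod_def)

lemma coprod_one: "coprod \<Omega> 1 = tens 1 1"
  by (simp add: coprod_def zero_fmon_def flip: single_one)

lemma coprod_theta: "coprod \<Omega> (theta i) = tens (theta i) 1 + tens 1 (theta i)"
  by (simp add: coprod_def theta_def tmult_one_right del: tmult_add_left)

lemma coprod_mult: "coprod \<Omega> (x * y) = tmult \<Omega> (coprod \<Omega> x) (coprod \<Omega> y)"
proof (induction x rule: poly_mapping_induct)
  case (single a c)
  show ?case
    by (induction y rule: poly_mapping_induct)
       (simp_all add: coprod_def mult_single plus_fmon_def coprod_word_append distrib_left mult.commute)
qed (simp_all add: coprod_def distrib_right)


section \<open>The bilinear form and its radical\<close>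

definition tform ::
  "('i::finite \<Rightarrow> 'i \<Rightarrow> int) \<Rightarrow> ('i falg \<Rightarrow> 'i falg \<Rightarrow> qvt) \<Rightarrow> 'i falg2 \<Rightarrow> 'i falg2 \<Rightarrow> qvt" where
  "tform \<Omega> B X Y =
     (\<Sum>(x1, x2)\<in>Poly_Mapping.keys X. \<Sum>(y1, y2)\<in>Poly_Mapping.keys Y.
        Poly_Mapping.lookup X (x1, x2) * Poly_Mapping.lookup Y (y1, y2) *
        (tt powi (2 * brk \<Omega> (weight x1) (weight x2)) *
         B (Poly_Mapping.single x1 1) (Poly_Mapping.single y1 1) *
         B (Poly_Mapping.single x2 1) (Poly_Mapping.single y2 1)))"

definition is_form :: "('i::finite \<Rightarrow> 'i \<Rightarrow> int) \<Rightarrow> ('i falg \<Rightarrow> 'i falg \<Rightarrow> qvt) \<Rightarrow> bool" where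
  "is_form \<Omega> B \<longleftrightarrow>
     (\<forall>y. Vector_Spaces.linear scal (*) (\<lambda>x. B x y)) \<and>
     (\<forall>x. Vector_Spaces.linear scal (*) (B x)) \<and>
     (\<forall>x y. B x y = B y x) \<and>
     B 1 1 = 1 \<and>
     (\<forall>i j. B (theta i) (theta j) = of_bool (i = j) * inverse (1 - v_at \<Omega> i powi (-2))) \<and>
     (\<forall>x y' y''. B x (y' * y'') = tform \<Omega> B (coprod \<Omega> x) (tens y' y'')) \<and>
     (\<forall>x' x'' y. B (x' * x'') y = tform \<Omega> B (tens x' x'') (coprod \<Omega> y))"

definition the_form :: "('i::finite \<Rightarrow> 'i \<Rightarrow> int) \<Rightarrow> 'i falg \<Rightarrow> 'i falg \<Rightarrow> qvt" where
  "the_form \<Omega> = (THE B. is_form \<Omega> B)"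

definition form_radical :: "('i falg \<Rightarrow> 'i falg \<Rightarrow> qvt) \<Rightarrow> 'i falg set" where
  "form_radical B = {x. \<forall>y. B x y = 0}"


section \<open>The Serre elements and two-sided ideals\<close>

text \<open>
  Two exact divisions: \<open>2 (i \<cdot> j) / (i \<cdot> i) = (\<Omega> i j + \<Omega> j i) / \<Omega> i i\<close> is an integer for a
  matrix \<open>\<Omega>\<close> as in the theorem, and \<open>i \<cdot> i\<close> is even.  The quotients
  \<open>2 \<langle>i, j\<rangle> / (i \<cdot> i)\<close> in the exponent of \<open>t_at \<Omega> i\<close> need not be integers; as \<open>t_at \<Omega> i\<close> is
  \<open>tt\<close> to the power \<open>(i \<cdot> i) / 2\<close>, multiplying that exponent by \<open>(i \<cdot> i) / 2\<close> gives the
  integral exponent of \<open>tt\<close> used here.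
\<close>

definition serre :: "('i::finite \<Rightarrow> 'i \<Rightarrow> int) \<Rightarrow> 'i \<Rightarrow> 'i \<Rightarrow> 'i falg" where
  "serre \<Omega> i j =
     (\<Sum>(p, p') | int p + int p' =
          1 - (2 * dot \<Omega> (simple i) (simple j)) div dot \<Omega> (simple i) (simple i).
        scal ((-1) ^ p *
              tt powi (- int p * (int p' * (dot \<Omega> (simple i) (simple i) div 2)
                         - ang \<Omega> (simple i) (simple j) + ang \<Omega> (simple j) (simple i))))
          (divpow \<Omega> i p * theta j * divpow \<Omega> i p'))"

definition two_sided_ideal :: "'a::ring_1 set \<Rightarrow> bool" where
  "two_sided_ideal J \<longleftrightarrow>
     0 \<in> J \<and> (\<forall>x\<in>J. \<forall>y\<in>J. x + y \<in> J) \<and> (\<forall>a. \<forall>x\<in>J. a * x \<in> J \<and> x * a \<in> J)"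

end

theory Submission
  imports Defs
begin

text \<open>
  Let \<open>J\<close> be the Serre ideal.  Up to a scalar, the Serre element is the iterated braided commutator
  \<open>(ad \<theta>\<^sub>i)\<^sup>n \<theta>\<^sub>j\<close>, which all left skew derivations annihilate; hence \<open>J\<close> lies in the radical.
  For the converse take a homogeneous \<open>x\<close> of minimal length in the radical but not in \<open>J\<close>, of weight
  \<open>\<beta>\<close>.  By minimality \<open>x\<close> is primitive modulo \<open>J\<close>, so the braided antipode maps it to \<open>- x\<close> modulo
  \<open>J\<close>.  The square of the antipode acts on weight \<open>\<beta>\<close> by a power of \<open>v\<close> with exponent
  \<open>(\<Sum>i. \<beta>\<^sub>i (i \<cdot> i)) - \<beta> \<cdot> \<beta>\<close>, so \<open>\<beta> \<cdot> \<beta> = (\<Sum>i. \<beta>\<^sub>i (i \<cdot> i)) > 0\<close>.  On the other hand the Serre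
  relations make \<open>ad \<theta>\<^sub>i\<close> nilpotent on \<open>x\<close> modulo \<open>J\<close>, and since the derivations kill \<open>x\<close> modulo \<open>J\<close>,
  rank-one representation theory gives \<open>\<beta> \<cdot> i \<le> 0\<close> for all \<open>i\<close>, whence \<open>\<beta> \<cdot> \<beta> \<le> 0\<close>.
\<close>

section \<open>Linear maps on the free algebra\<close>

text \<open>The vanishing exponent of the squared antipode is the braided form of the condition
  2(rho, \<beta>) = (\<beta>, \<beta>) that the Casimir operator yields in the Gabber-Kac theorem.
  The parameter t leaves no trace in it, because the t-exponents of the braiding are antisymmetric
  and cancel in a double braiding.

  Two obstacles shape the argument. Minimality speaks about single elements, whereas primitivity
  concerns a tensor; the passage is an elimination that uses functionals of the form, and it
  requires the antipode to preserve the radical. Moreover, ad theta_i is not nilpotent on the free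
  algebra: it sends theta_i to nonzero multiples of all its powers. Nilpotence modulo J is available
  for elements built from 1 and the theta_j with j \<noteq> i by products and by ad theta_i, and
  these are killed by the right derivation of i. Hence x is expanded in powers of theta_i with such
  coefficients on the left; the iterated right derivatives of x, which lie in J by minimality, show
  that x agrees with its zeroth coefficient modulo J.\<close>

lemma scal_eq_mult: "scal c x = Poly_Mapping.single 0 c * (x :: 'a::monoid_add \<Rightarrow>\<^sub>0 qvt)"
  by (induction x rule: poly_mapping_induct) (simp_all add: mult_single distrib_left)

lemma scal_mult_left [simp]: "scal c x * y = scal c (x * (y :: 'a::monoid_add \<Rightarrow>\<^sub>0 qvt))"
  by (simp add: scal_eq_mult mult.assoc)

lemma scal_mult_right [simp]: "x * scal c y = scal c (x * (y :: 'a::monoid_add \<Rightarrow>\<^sub>0 qvt))"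
proof (induction x rule: poly_mapping_induct)
  case (single a d)
  show ?case
    by (induction y rule: poly_mapping_induct) (simp_all add: mult_single distrib_left mult_ac)
qed (simp_all add: distrib_right)

lemma scal_minus [simp]: "scal c (- x) = - scal c x" "scal (- c) x = - scal c x"
  by (auto intro!: poly_mapping_eqI)

lemma scal_diff [simp]: "scal c (x - y) = scal c x - scal c y"
  by (simp only: diff_conv_add_uminus scal_simps scal_minus)

lemma scal_diff_left: "scal (c - d) x = scal c x - scal d x"
  by (simp only: diff_conv_add_uminus scal_add_left scal_minus)

lemma scal_sum: "scal c (sum f A) = (\<Sum>a\<in>A. scal c (f a))"
  by (induction A rule: infinite_finite_induct) simp_all

lemma linext_minus [simp]: "linext f (- x) = - linext f x"
  using linext_scal[of f "-1" x] by simp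

lemma linext_diff [simp]: "linext f (x - y) = linext f x - linext f y"
  using linext_add[of f x "- y"] by simp

text \<open>Generators multiply on the left only, matching the recursion over words behind the
  coproduct, the derivations, the form and the antipode.\<close>

lemma falg_induct [case_names one theta scal add]:
  fixes x :: "'i falg"
  assumes one: "P 1"
    and theta: "\<And>i x. P x \<Longrightarrow> P (theta i * x)"
    and scal: "\<And>c x. P x \<Longrightarrow> P (scal c x)"
    and add: "\<And>x y. P x \<Longrightarrow> P y \<Longrightarrow> P (x + y)"
  shows "P x"
proof (induction x rule: poly_mapping_induct)
  case zero
  show ?case using scal[OF one, of 0] by simp
next
  case (single a c)
  have "P (Poly_Mapping.single (FMon l) 1)" for l
  proof (induction l)
    case Nil
    then show ?case using one by (simp add: zero_fmon_def flip: single_one)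
  next
    case (Cons i l)
    have "Poly_Mapping.single (FMon (i # l)) 1 = theta i * Poly_Mapping.single (FMon l) 1"
      by (simp add: theta_def mult_single plus_fmon_def)
    then show ?case using theta[OF Cons] by simp
  qed
  from scal[OF this, of c "letters a"] show ?case by simp
qed (rule add)

text \<open>The counit.\<close>

definition eps :: "'i falg \<Rightarrow> qvt" where "eps x = Poly_Mapping.lookup x 0"

lemma eps_theta_mult [simp]: "eps (theta i * x) = 0"
  unfolding eps_def
  by (induction x rule: poly_mapping_induct)
     (auto simp: theta_def mult_single distrib_left lookup_add lookup_single when_def
        plus_fmon_def zero_fmon_def)

lemma eps_simps [simp]: "eps 0 = 0" "eps 1 = 1" "eps (x + y) = eps x + eps y"
  "eps (scal c x) = c * eps x" "eps (x - y) = eps x - eps y" "eps (- x) = - eps x"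
  by (simp_all add: eps_def lookup_add lookup_one lookup_minus)

lemma eps_theta [simp]: "eps (theta i) = 0"
  using eps_theta_mult[of i 1] by simp

text \<open>One family for all operators acting by a scalar on each weight space: braiding, twist
  and the weight projections. The function stays arbitrary so that inductions can replace
  \<open>f\<close> by \<open>shift i f\<close> when a letter is pulled out.\<close>

definition wdiag :: "(('i \<Rightarrow> int) \<Rightarrow> qvt) \<Rightarrow> 'i falg \<Rightarrow> 'i falg" where
  "wdiag f = linext (\<lambda>w. Poly_Mapping.single w (f (weight w)))"

definition shift :: "'i \<Rightarrow> (('i \<Rightarrow> int) \<Rightarrow> qvt) \<Rightarrow> ('i \<Rightarrow> int) \<Rightarrow> qvt" where
  "shift i f = (\<lambda>\<beta>. f (\<lambda>k. simple i k + \<beta> k))"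

lemma weight_letter: "weight (FMon [i]) = simple i"
  by (auto simp: weight_def simple_def)

lemma wdiag_linear [simp]:
  "wdiag f 0 = 0" "wdiag f (x + y) = wdiag f x + wdiag f y"
  "wdiag f (scal c x) = scal c (wdiag f x)" "wdiag f (x - y) = wdiag f x - wdiag f y"
  "wdiag f (- x) = - wdiag f x"
  by (simp_all add: wdiag_def)

lemma wdiag_one [simp]: "wdiag f 1 = scal (f (\<lambda>_. 0)) 1"
  by (simp add: wdiag_def flip: single_one)

lemma wdiag_theta_mult: "wdiag f (theta i * x) = theta i * wdiag (shift i f) x"
  by (induction x rule: poly_mapping_induct)
     (simp_all add: wdiag_def theta_def mult_single distrib_left shift_def weight_letter)

lemma lookup_wdiag: "Poly_Mapping.lookup (wdiag f x) w = f (weight w) * Poly_Mapping.lookup x w"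
  by (induction x rule: poly_mapping_induct)
     (auto simp: wdiag_def lookup_add algebra_simps lookup_single when_def)

lemma wdiag_wdiag: "wdiag f (wdiag g x) = wdiag (\<lambda>\<beta>. f \<beta> * g \<beta>) x"
  by (rule poly_mapping_eqI) (simp add: lookup_wdiag)

lemma wdiag_const [simp]: "wdiag (\<lambda>_. c) x = scal c x"
  by (rule poly_mapping_eqI) (simp add: lookup_wdiag)

lemma wdiag_commute: "wdiag f (wdiag g x) = wdiag g (wdiag f x)"
  by (simp add: wdiag_wdiag mult.commute)

lemma wdiag_cmult: "wdiag (\<lambda>\<beta>. c * f \<beta>) x = scal c (wdiag f x)"
  by (rule poly_mapping_eqI) (simp add: lookup_wdiag)

lemma wdiag_mult:
  assumes "\<And>\<alpha> \<beta>. f (\<lambda>k. \<alpha> k + \<beta> k) = f \<alpha> * f \<beta>"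
  shows "wdiag f (x * y) = wdiag f x * wdiag f y"
proof (induction x rule: poly_mapping_induct)
  case (single a c)
  show ?case
    by (induction y rule: poly_mapping_induct)
       (simp_all add: wdiag_def mult_single distrib_left assms mult_ac)
qed (simp_all add: distrib_right)

lemma eps_wdiag: "eps (wdiag f x) = f (\<lambda>_. 0) * eps x"
  by (simp add: eps_def lookup_wdiag)

lemma coprod_theta_mult:
  "coprod \<Omega> (theta i * x) = tmult \<Omega> (tens (theta i) 1) (coprod \<Omega> x) + tmult \<Omega> (tens 1 (theta i)) (coprod \<Omega> x)"
  by (simp add: coprod_mult coprod_theta)

lemma tens_linear [simp]:
  "tens (x + x') y = tens x y + tens x' y" "tens x (y + y') = tens x y + tens x y'"
  "tens (scal c x) y = scal c (tens x y)" "tens x (scal c y) = scal c (tens x y)"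
  "tens 0 y = 0" "tens x 0 = 0"
  by (simp_all add: tens_def linext_fun_add linext_fun_scal) (simp add: linext_def)

lemma tens_single: "tens (Poly_Mapping.single a c) (Poly_Mapping.single b d) = Poly_Mapping.single (a, b) (c * d)"
  by (simp add: tens_def)

lemma falg2_induct [case_names tens add]:
  assumes "\<And>x y. P (tens x y)" "\<And>X Y. P X \<Longrightarrow> P Y \<Longrightarrow> P (X + Y)"
  shows "P X"
proof (induction X rule: poly_mapping_induct)
  case zero
  show ?case using assms(1)[of 0 0] by simp
next
  case (single p c)
  show ?case using assms(1)[of "Poly_Mapping.single (fst p) c" "Poly_Mapping.single (snd p) 1"]
    by (simp add: tens_single)
qed (rule assms(2))

section \<open>Skew derivations and the form\<close>

lemma bilin_simple: "bilin M (simple i) (simple j) = M i j"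
proof -
  have "bilin M (simple i) (simple j) = (\<Sum>k\<in>UNIV. \<Sum>l\<in>UNIV. if l = j then if k = i then M k l else 0 else 0)"
    unfolding bilin_def simple_def by (intro sum.cong) auto
  then show ?thesis by (simp add: sum.delta)
qed

lemma shift_commute: "shift i (shift j f) = shift j (shift i f)"
  by (simp add: shift_def add_ac)

definition linfun :: "('b \<Rightarrow> qvt) \<Rightarrow> ('b \<Rightarrow>\<^sub>0 qvt) \<Rightarrow> qvt" where
  "linfun f x = (\<Sum>a\<in>Poly_Mapping.keys x. Poly_Mapping.lookup x a * f a)"

lemma linfun_superset:
  assumes "finite A" "Poly_Mapping.keys x \<subseteq> A"
  shows "linfun f x = (\<Sum>a\<in>A. Poly_Mapping.lookup x a * f a)"
  unfolding linfun_def
  by (rule sum.mono_neutral_left) (use assms in \<open>auto simp: in_keys_iff\<close>)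

lemma linfun_add [simp]: "linfun f (x + y) = linfun f x + linfun f y"
  using keys_add[of x y]
  by (simp add: linfun_superset[of "Poly_Mapping.keys x \<union> Poly_Mapping.keys y"] lookup_add
      distrib_right sum.distrib)

lemma linfun_single [simp]: "linfun f (Poly_Mapping.single a c) = c * f a"
  by (cases "c = 0") (simp_all add: linfun_def)

lemma linfun_zero [simp]: "linfun f 0 = 0"
  by (simp add: linfun_def)

lemma linfun_scal [simp]: "linfun f (scal c x) = c * linfun f x"
  by (induction x rule: poly_mapping_induct) (simp_all add: algebra_simps)

lemma linfun_fun_add: "linfun (\<lambda>a. f a + g a) x = linfun f x + linfun g x"
  by (simp add: linfun_def sum.distrib distrib_left)

locale twisted_form =
  fixes \<Omega> :: "'i::finite \<Rightarrow> 'i \<Rightarrow> int"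
begin

text \<open>The braiding: \<open>(1 \<otimes> x) (y \<otimes> 1) = chi |x| |y| (y \<otimes> x)\<close> in the twisted tensor square.\<close>

definition chi :: "('i \<Rightarrow> int) \<Rightarrow> ('i \<Rightarrow> int) \<Rightarrow> qvt" where
  "chi \<alpha> \<beta> = vv powi (- dot \<Omega> \<beta> \<alpha>) * tt powi (ang \<Omega> \<beta> \<alpha> - ang \<Omega> \<alpha> \<beta>)"

definition twist :: "('i \<Rightarrow> int) \<Rightarrow> ('i \<Rightarrow> int) \<Rightarrow> qvt" where
  "twist \<alpha> \<beta> = tt powi (2 * brk \<Omega> \<alpha> \<beta>)"

abbreviation q :: "'i \<Rightarrow> 'i \<Rightarrow> qvt" where "q i j \<equiv> chi (simple i) (simple j)"

text \<open>In the twisted square, moving \<open>theta i\<close> rightwards over x from the second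
  factor gives (1 \<otimes> theta i)(x \<otimes> 1) = \<open>tau i x\<close> \<otimes> theta i, and
  dually (1 \<otimes> x)(theta i \<otimes> 1) = theta i \<otimes> \<open>sig i x\<close>. The
  operators \<open>om i\<close> and \<open>om' i\<close> carry the factor t^(2[,]) of the form on
  the square when the left, respectively right, tensor factor is \<open>theta i\<close>.\<close>

abbreviation tau :: "'i \<Rightarrow> 'i falg \<Rightarrow> 'i falg" where "tau i \<equiv> wdiag (chi (simple i))"
abbreviation sig :: "'i \<Rightarrow> 'i falg \<Rightarrow> 'i falg" where "sig i \<equiv> wdiag (\<lambda>\<beta>. chi \<beta> (simple i))"
abbreviation om :: "'i \<Rightarrow> 'i falg \<Rightarrow> 'i falg" where "om i \<equiv> wdiag (twist (simple i))"
abbreviation om' :: "'i \<Rightarrow> 'i falg \<Rightarrow> 'i falg" where "om' i \<equiv> wdiag (\<lambda>\<beta>. twist \<beta> (simple i))"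

lemma chi_zero [simp]: "chi (\<lambda>_. 0) \<beta> = 1" "chi \<alpha> (\<lambda>_. 0) = 1"
  and twist_zero [simp]: "twist (\<lambda>_. 0) \<beta> = 1" "twist \<alpha> (\<lambda>_. 0) = 1"
  by (simp_all add: chi_def twist_def dot_def ang_def brk_def)

lemma chi_nonzero [simp]: "chi \<alpha> \<beta> \<noteq> 0" and twist_nonzero [simp]: "twist \<alpha> \<beta> \<noteq> 0"
  by (simp_all add: chi_def twist_def)

lemma chi_add: "chi (\<lambda>k. \<alpha> k + \<alpha>' k) \<beta> = chi \<alpha> \<beta> * chi \<alpha>' \<beta>"
  "chi \<alpha> (\<lambda>k. \<beta> k + \<beta>' k) = chi \<alpha> \<beta> * chi \<alpha> \<beta>'"
  and twist_add: "twist (\<lambda>k. \<alpha> k + \<alpha>' k) \<beta> = twist \<alpha> \<beta> * twist \<alpha>' \<beta>"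
  "twist \<alpha> (\<lambda>k. \<beta> k + \<beta>' k) = twist \<alpha> \<beta> * twist \<alpha> \<beta>'"
  by (simp_all add: chi_def twist_def dot_def ang_def brk_def power_int_add power_int_diff
      power_int_minus field_simps)

lemma shift_chi: "shift i (chi \<alpha>) = (\<lambda>\<beta>. chi \<alpha> (simple i) * chi \<alpha> \<beta>)"
  "shift i (\<lambda>\<beta>. chi \<beta> \<alpha>) = (\<lambda>\<beta>. chi (simple i) \<alpha> * chi \<beta> \<alpha>)"
  and shift_twist: "shift i (twist \<alpha>) = (\<lambda>\<beta>. twist \<alpha> (simple i) * twist \<alpha> \<beta>)"
  "shift i (\<lambda>\<beta>. twist \<beta> \<alpha>) = (\<lambda>\<beta>. twist (simple i) \<alpha> * twist \<beta> \<alpha>)"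
  by (simp_all add: shift_def chi_add twist_add)

lemma wdiag_theta_mult_simps [simp]:
  "wdiag (chi \<alpha>) (theta i * x) = scal (chi \<alpha> (simple i)) (theta i * wdiag (chi \<alpha>) x)"
  "wdiag (\<lambda>\<beta>. chi \<beta> \<alpha>) (theta i * x) = scal (chi (simple i) \<alpha>) (theta i * wdiag (\<lambda>\<beta>. chi \<beta> \<alpha>) x)"
  "wdiag (twist \<alpha>) (theta i * x) = scal (twist \<alpha> (simple i)) (theta i * wdiag (twist \<alpha>) x)"
  "wdiag (\<lambda>\<beta>. twist \<beta> \<alpha>) (theta i * x) = scal (twist (simple i) \<alpha>) (theta i * wdiag (\<lambda>\<beta>. twist \<beta> \<alpha>) x)"
  by (simp_all add: wdiag_theta_mult shift_chi shift_twist wdiag_cmult)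

lemma wdiag_theta [simp]:
  "wdiag (chi \<alpha>) (theta i) = scal (chi \<alpha> (simple i)) (theta i)"
  "wdiag (\<lambda>\<beta>. chi \<beta> \<alpha>) (theta i) = scal (chi (simple i) \<alpha>) (theta i)"
  "wdiag (twist \<alpha>) (theta i) = scal (twist \<alpha> (simple i)) (theta i)"
  "wdiag (\<lambda>\<beta>. twist \<beta> \<alpha>) (theta i) = scal (twist (simple i) \<alpha>) (theta i)"
  using wdiag_theta_mult_simps[of \<alpha> i 1] by simp_all

lemma wdiag_chi_mult:
  "wdiag (chi \<alpha>) (x * y) = wdiag (chi \<alpha>) x * wdiag (chi \<alpha>) y"
  "wdiag (\<lambda>\<beta>. chi \<beta> \<alpha>) (x * y) = wdiag (\<lambda>\<beta>. chi \<beta> \<alpha>) x * wdiag (\<lambda>\<beta>. chi \<beta> \<alpha>) y"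
  by (rule wdiag_mult, simp add: chi_add)+

text \<open>\<open>lder i x\<close> and \<open>rder i x\<close> are the components of the coproduct
  r(x) of the shape theta i \<otimes> y and y \<otimes> theta i. The recursions follow from r(theta
  j * x) = (theta j \<otimes> 1 + 1 \<otimes> theta j) r(x), where \<open>q j i\<close> and
  \<open>tau i\<close> are the braidings incurred.\<close>

primrec lder_word :: "'i \<Rightarrow> 'i list \<Rightarrow> 'i falg" where
  "lder_word i [] = 0"
| "lder_word i (j # w) = scal (of_bool (i = j)) (Poly_Mapping.single (FMon w) 1) +
     scal (q j i) (theta j * lder_word i w)"

definition lder :: "'i \<Rightarrow> 'i falg \<Rightarrow> 'i falg" where
  "lder i = linext (\<lambda>w. lder_word i (letters w))"

primrec rder_word :: "'i \<Rightarrow> 'i list \<Rightarrow> 'i falg" where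
  "rder_word i [] = 0"
| "rder_word i (j # w) = theta j * rder_word i w +
     scal (of_bool (i = j)) (tau i (Poly_Mapping.single (FMon w) 1))"

definition rder :: "'i \<Rightarrow> 'i falg \<Rightarrow> 'i falg" where
  "rder i = linext (\<lambda>w. rder_word i (letters w))"

lemma lder_linear [simp]:
  "lder i 0 = 0" "lder i (x + y) = lder i x + lder i y"
  "lder i (scal c x) = scal c (lder i x)" "lder i (x - y) = lder i x - lder i y"
  "lder i (- x) = - lder i x"
  by (simp_all add: lder_def)

lemma rder_linear [simp]:
  "rder i 0 = 0" "rder i (x + y) = rder i x + rder i y"
  "rder i (scal c x) = scal c (rder i x)" "rder i (x - y) = rder i x - rder i y"
  "rder i (- x) = - rder i x"
  by (simp_all add: rder_def)

lemma lder_one [simp]: "lder i 1 = 0" and rder_one [simp]: "rder i 1 = 0"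
  by (simp_all add: lder_def rder_def zero_fmon_def flip: single_one)

lemma lder_theta_mult [simp]:
  "lder i (theta j * x) = scal (of_bool (i = j)) x + scal (q j i) (theta j * lder i x)"
proof (induction x rule: poly_mapping_induct)
  case (single a c)
  then show ?case
    by (cases a) (auto simp: lder_def theta_def mult_single plus_fmon_def mult_ac)
qed (simp_all add: distrib_left)

lemma rder_theta_mult [simp]:
  "rder i (theta j * x) = theta j * rder i x + scal (of_bool (i = j)) (tau i x)"
proof (induction x rule: poly_mapping_induct)
  case (single a c)
  have "rder_word i (j # letters a) = theta j * rder_word i (letters a) +
    scal (of_bool (i = j)) (tau i (Poly_Mapping.single a 1))" by simp
  moreover have "tau i (Poly_Mapping.single a c) = scal c (tau i (Poly_Mapping.single a 1))"
    by (simp flip: wdiag_linear(3))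
  ultimately show ?case
    by (simp add: rder_def theta_def mult_single plus_fmon_def mult_ac del: rder_word.simps)
qed (simp_all add: distrib_left)

lemma lder_theta [simp]: "lder i (theta j) = scal (of_bool (i = j)) 1"
  and rder_theta [simp]: "rder i (theta j) = scal (of_bool (i = j)) 1"
  using lder_theta_mult[of i j 1] rder_theta_mult[of i j 1] by simp_all

lemma lder_wdiag: "lder i (wdiag f x) = wdiag (shift i f) (lder i x)"
proof (induction x arbitrary: f rule: falg_induct)
  case (theta j x)
  then show ?case by (cases "i = j") (simp_all add: wdiag_theta_mult shift_commute)
qed simp_all

lemma rder_wdiag: "rder i (wdiag f x) = wdiag (shift i f) (rder i x)"
proof (induction x arbitrary: f rule: falg_induct)
  case (theta j x)
  then show ?case
    by (cases "i = j") (simp_all add: wdiag_theta_mult shift_commute wdiag_commute)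
qed simp_all

lemma lder_wdiag_simps [simp]:
  "lder i (wdiag (chi \<alpha>) x) = scal (chi \<alpha> (simple i)) (wdiag (chi \<alpha>) (lder i x))"
  "lder i (wdiag (\<lambda>\<beta>. chi \<beta> \<alpha>) x) = scal (chi (simple i) \<alpha>) (wdiag (\<lambda>\<beta>. chi \<beta> \<alpha>) (lder i x))"
  "lder i (wdiag (twist \<alpha>) x) = scal (twist \<alpha> (simple i)) (wdiag (twist \<alpha>) (lder i x))"
  "lder i (wdiag (\<lambda>\<beta>. twist \<beta> \<alpha>) x) = scal (twist (simple i) \<alpha>) (wdiag (\<lambda>\<beta>. twist \<beta> \<alpha>) (lder i x))"
  by (simp_all add: lder_wdiag shift_chi shift_twist wdiag_cmult)

lemma rder_wdiag_simps [simp]: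
  "rder i (wdiag (chi \<alpha>) x) = scal (chi \<alpha> (simple i)) (wdiag (chi \<alpha>) (rder i x))"
  "rder i (wdiag (\<lambda>\<beta>. chi \<beta> \<alpha>) x) = scal (chi (simple i) \<alpha>) (wdiag (\<lambda>\<beta>. chi \<beta> \<alpha>) (rder i x))"
  "rder i (wdiag (twist \<alpha>) x) = scal (twist \<alpha> (simple i)) (wdiag (twist \<alpha>) (rder i x))"
  "rder i (wdiag (\<lambda>\<beta>. twist \<beta> \<alpha>) x) = scal (twist (simple i) \<alpha>) (wdiag (\<lambda>\<beta>. twist \<beta> \<alpha>) (rder i x))"
  by (simp_all add: rder_wdiag shift_chi shift_twist wdiag_cmult)

lemma lder_mult: "lder i (x * y) = lder i x * y + sig i x * lder i y"
  by (induction x rule: falg_induct) (simp_all add: algebra_simps)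

lemma rder_mult: "rder i (x * y) = x * rder i y + rder i x * tau i y"
  by (induction x rule: falg_induct) (simp_all add: algebra_simps wdiag_chi_mult)

text \<open>Coassociativity: both sides are the middle factor of the part of the iterated coproduct
  with \<open>theta i\<close> first and \<open>theta j\<close> last.\<close>

lemma lder_rder_commute: "lder i (rder j x) = rder j (lder i x)"
  by (induction x rule: falg_induct) (simp_all add: algebra_simps)

lemma eps_lder_eq_eps_rder: "eps (lder i x) = eps (rder i x)"
  by (induction x rule: falg_induct) (simp_all add: eps_wdiag)

section \<open>Existence and symmetry of the form\<close>

definition theta_norm :: "'i \<Rightarrow> qvt" where "theta_norm i = inverse (1 - v_at \<Omega> i powi (-2))"

text \<open>The recursion is forced by the axioms: in (theta i \<otimes> w, r(y)) only the summand
  theta i \<otimes> \<open>lder i y\<close> of r(y) contributes, and the form on the tensor square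
  supplies the twist.\<close>

primrec bform_word :: "'i list \<Rightarrow> 'i falg \<Rightarrow> qvt" where
  "bform_word [] y = eps y"
| "bform_word (i # w) y = theta_norm i * twist (simple i) (weight (FMon w)) * bform_word w (lder i y)"

definition bform :: "'i falg \<Rightarrow> 'i falg \<Rightarrow> qvt" where
  "bform x y = linfun (\<lambda>w. bform_word (letters w) y) x"

lemma bform_add_left [simp]: "bform (x + x') y = bform x y + bform x' y"
  and bform_zero_left [simp]: "bform 0 y = 0"
  and bform_scal_left [simp]: "bform (scal c x) y = c * bform x y"
  and bform_single: "bform (Poly_Mapping.single w c) y = c * bform_word (letters w) y"
  by (simp_all add: bform_def)

lemma bform_word_linear: "bform_word w (y + y') = bform_word w y + bform_word w y'"
  "bform_word w (scal c y) = c * bform_word w y"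
  by (induction w arbitrary: y y') (simp_all add: algebra_simps)

lemma bform_add_right [simp]: "bform x (y + y') = bform x y + bform x y'"
  and bform_scal_right [simp]: "bform x (scal c y) = c * bform x y"
  by (induction x rule: poly_mapping_induct) (simp_all add: bform_single bform_word_linear algebra_simps)

lemma bform_zero_right [simp]: "bform x 0 = 0"
  using bform_scal_right[of x 0 0] by simp

lemma bform_diff_right [simp]: "bform x (y - y') = bform x y - bform x y'"
  using bform_add_right[of x y' "y - y'"] by simp

lemma bform_one [simp]: "bform 1 y = eps y"
  by (simp add: bform_single zero_fmon_def flip: single_one)

lemma bform_theta_mult: "bform (theta i * x) y = theta_norm i * bform (om i x) (lder i y)"
  by (induction x rule: poly_mapping_induct)
     (simp_all add: bform_single distrib_left theta_def mult_single plus_fmon_def wdiag_def mult_ac)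

text \<open>Self-adjointness of weight-diagonal operators; for an indicator function it says that
  distinct weight spaces are orthogonal.\<close>

lemma bform_wdiag: "bform (wdiag f x) y = bform x (wdiag f y)"
  by (induction x arbitrary: f y rule: falg_induct)
     (simp_all add: wdiag_theta_mult bform_theta_mult wdiag_wdiag lder_wdiag eps_wdiag
       wdiag_commute[of "twist _"])

text \<open>For i \<noteq> j both sides have t-exponent - \<Omega> i j - \<Omega> j i: the factor
  t^(2[,]) symmetrises the braiding. The symmetry of \<open>bform\<close> rests on this
  identity.\<close>

lemma q_twist_swap: "q i j * twist (simple j) (simple i) = q j i * twist (simple i) (simple j)"
proof (cases "i = j")
  case False
  have c: "- \<Omega> j i - \<Omega> i j = - \<Omega> i j - \<Omega> j i"
    by simp
  have *: "vv powi a * tt powi (x - y) * tt powi (- 2 * x) = vv powi a * tt powi (- x - y)" for a x y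
    by (simp add: mult.assoc flip: power_int_add)
  show ?thesis
    using False *[of "- \<Omega> i j - \<Omega> j i" "\<Omega> j i" "\<Omega> i j"] *[of "- \<Omega> i j - \<Omega> j i" "\<Omega> i j" "\<Omega> j i"]
    by (simp add: chi_def twist_def dot_def ang_def brk_def bilin_simple c algebra_simps)
qed simp

lemma bform_theta_right: "bform y (theta i * x) = theta_norm i * bform (lder i y) (om i x)"
proof (induction y arbitrary: x rule: falg_induct)
  case (theta j y)
  have "bform (theta j * y) (theta i * x) = theta_norm j * bform y (om j (lder j (theta i * x)))"
    by (simp add: bform_theta_mult bform_wdiag)
  also have "\<dots> = of_bool (i = j) * theta_norm i * bform y (om i x)
     + q i j * twist (simple j) (simple i) * theta_norm j * bform y (theta i * om j (lder j x))"
    by (simp add: algebra_simps)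
  also have "\<dots> = of_bool (i = j) * theta_norm i * bform y (om i x)
     + q i j * twist (simple j) (simple i) * theta_norm j * theta_norm i * bform (lder i y) (om i (om j (lder j x)))"
    by (simp add: theta.IH)
  also have "\<dots> = theta_norm i * bform (lder i (theta j * y)) (om i x)"
    by (simp add: bform_theta_mult bform_wdiag q_twist_swap wdiag_commute[of "twist (simple i)"] algebra_simps)
  finally show ?case .
qed (simp_all add: algebra_simps)

lemma bform_commute: "bform x y = bform y x"
proof (induction x arbitrary: y rule: falg_induct)
  case one
  show ?case
    by (induction y rule: falg_induct) (simp_all add: bform_theta_mult)
next
  case (theta i x)
  then show ?case by (simp add: bform_theta_mult bform_theta_right bform_wdiag)
qed simp_all

text \<open>A letter on the left of \<open>x\<close> is removed by an \<open>lder\<close>, which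
  commutes with \<open>rder i\<close>; so right multiplication by \<open>theta i\<close> is adjoint
  to \<open>rder i\<close> up to the twist.\<close>

lemma bform_mult_theta: "bform (x * theta i) y = theta_norm i * bform (om' i x) (rder i y)"
proof (induction x arbitrary: y rule: falg_induct)
  case one
  then show ?case using bform_theta_mult[of i 1 y] by (simp add: eps_lder_eq_eps_rder)
next
  case (theta j x)
  have "bform (theta j * x * theta i) y = theta_norm j * bform (x * theta i) (om j (lder j y))"
    by (simp add: bform_theta_mult bform_wdiag mult.assoc)
  also have "\<dots> = theta_norm j * theta_norm i * twist (simple j) (simple i) * bform (om' i x) (om j (lder j (rder i y)))"
    by (simp add: theta.IH lder_rder_commute)
  also have "\<dots> = theta_norm i * bform (om' i (theta j * x)) (rder i y)"
    by (simp add: bform_theta_mult bform_wdiag)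
  finally show ?case .
qed (simp_all add: algebra_simps)

end

section \<open>Coproduct and uniqueness of the form\<close>

lemma linear_scal_iff:
  fixes f :: "('b \<Rightarrow>\<^sub>0 qvt) \<Rightarrow> qvt"
  shows "Vector_Spaces.linear scal (*) f \<longleftrightarrow>
    (\<forall>x y. f (x + y) = f x + f y) \<and> (\<forall>c x. f (scal c x) = c * f x)"
proof -
  have "vector_space (scal :: qvt \<Rightarrow> ('b \<Rightarrow>\<^sub>0 qvt) \<Rightarrow> _)"
    by unfold_locales (simp_all add: scal_add_left)
  moreover have "vector_space ((*) :: qvt \<Rightarrow> qvt \<Rightarrow> qvt)"
    by unfold_locales (simp_all add: algebra_simps)
  ultimately show ?thesis by (simp add: Vector_Spaces.linear_iff)
qed

abbreviation linear_form :: "(('b \<Rightarrow>\<^sub>0 qvt) \<Rightarrow> qvt) \<Rightarrow> bool" where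
  "linear_form \<equiv> Vector_Spaces.linear scal (*)"

lemma linear_form_simps:
  assumes "linear_form f"
  shows "f (x + y) = f x + f y" "f (scal c x) = c * f x" "f 0 = 0"
proof -
  show "f (x + y) = f x + f y" and s: "f (scal c x) = c * f x" for c x y
    using assms by (simp_all add: linear_scal_iff)
  show "f 0 = 0" using s[of 0 0] by simp
qed

lemma linear_form_single:
  assumes "linear_form f"
  shows "f (Poly_Mapping.single a c) = c * f (Poly_Mapping.single a 1)"
  using linear_form_simps(2)[OF assms, of c "Poly_Mapping.single a 1"] by simp

definition pair :: "('i falg \<Rightarrow> qvt) \<Rightarrow> ('i falg \<Rightarrow> qvt) \<Rightarrow> 'i falg2 \<Rightarrow> qvt" where
  "pair f g = linfun (\<lambda>p. f (Poly_Mapping.single (fst p) 1) * g (Poly_Mapping.single (snd p) 1))"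

lemma pair_linear [simp]: "pair f g (X + Y) = pair f g X + pair f g Y"
  "pair f g (scal c X) = c * pair f g X" "pair f g 0 = 0"
  by (simp_all add: pair_def)

lemma pair_single: "pair f g (Poly_Mapping.single (a, b) c) =
    c * (f (Poly_Mapping.single a 1) * g (Poly_Mapping.single b 1))"
  by (simp add: pair_def)

lemma pair_tens:
  assumes "linear_form f" "linear_form g"
  shows "pair f g (tens x y) = f x * g y"
proof (induction x rule: poly_mapping_induct)
  case (single a c)
  show ?case
  proof (induction y rule: poly_mapping_induct)
    case (single b d)
    show ?case
      by (simp add: tens_single pair_single linear_form_single[OF assms(1), of _ c]
          linear_form_single[OF assms(2), of _ d])
  qed (simp_all add: linear_form_simps[OF assms(2)] distrib_left)
qed (simp_all add: linear_form_simps[OF assms(1)] distrib_right)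

lemma tens_single_one:
  "tens (Poly_Mapping.single a c) 1 = Poly_Mapping.single (a, 0) c"
  "tens 1 (Poly_Mapping.single a c) = Poly_Mapping.single (0, a) c"
  using tens_single[of a c 0 1] tens_single[of 0 1 a c] by simp_all

definition counit_left :: "'i falg2 \<Rightarrow> 'i falg" where
  "counit_left = linext (\<lambda>p. scal (eps (Poly_Mapping.single (fst p) 1)) (Poly_Mapping.single (snd p) 1))"

definition counit_right :: "'i falg2 \<Rightarrow> 'i falg" where
  "counit_right = linext (\<lambda>p. scal (eps (Poly_Mapping.single (snd p) 1)) (Poly_Mapping.single (fst p) 1))"

lemma eps_single: "eps (Poly_Mapping.single a c) = c * eps (Poly_Mapping.single a 1)"
  by (simp add: eps_def lookup_single when_def)

lemma counit_linear [simp]: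
  "counit_left (X + Y) = counit_left X + counit_left Y" "counit_left (scal c X) = scal c (counit_left X)"
  "counit_right (X + Y) = counit_right X + counit_right Y" "counit_right (scal c X) = scal c (counit_right X)"
  "counit_left 0 = 0" "counit_right 0 = 0"
  by (simp_all add: counit_left_def counit_right_def)

lemma counit_tens:
  "counit_left (tens x y) = scal (eps x) y" "counit_right (tens x y) = scal (eps y) x"
proof -
  have "counit_left (tens x y) = scal (eps x) y \<and> counit_right (tens x y) = scal (eps y) x"
  proof (induction x rule: poly_mapping_induct)
    case (single a c)
    show ?case
    proof (induction y rule: poly_mapping_induct)
      case (single b d)
      show ?case
        by (simp add: tens_single counit_left_def counit_right_def mult_ac
            eps_single[of _ c] eps_single[of _ d])
    qed (simp_all add: distrib_right single_add)
  qed (simp_all add: scal_add_left)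
  then show "counit_left (tens x y) = scal (eps x) y" "counit_right (tens x y) = scal (eps y) x"
    by simp_all
qed

context twisted_form
begin

lemma tmult_theta_tens:
  "tmult \<Omega> (tens (theta j) 1) (tens x y) = tens (theta j * x) y" (is ?A)
  "tmult \<Omega> (tens 1 (theta j)) (tens x y) = tens (tau j x) (theta j * y)" (is ?B)
proof -
  have "?A \<and> ?B"
  proof (induction x rule: poly_mapping_induct)
    case (single a c)
    show ?case
    proof (induction y rule: poly_mapping_induct)
      case (single b d)
      show ?case
        by (simp add: tens_single tens_single_one theta_def tmult_single mult_single wdiag_def chi_def
            weight_letter dot_def ang_def mult_ac)
    qed (simp_all add: distrib_left)
  qed (simp_all add: distrib_left)
  then show ?A ?B by blast+
qed

definition lder_left :: "'i \<Rightarrow> 'i falg2 \<Rightarrow> 'i falg2" where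
  "lder_left i = linext (\<lambda>p. tens (lder i (Poly_Mapping.single (fst p) 1)) (Poly_Mapping.single (snd p) 1))"

lemma lder_left_linear [simp]:
  "lder_left i (X + Y) = lder_left i X + lder_left i Y"
  "lder_left i (scal c X) = scal c (lder_left i X)" "lder_left i 0 = 0"
  by (simp_all add: lder_left_def)

lemma lder_single: "lder i (Poly_Mapping.single a c) = scal c (lder i (Poly_Mapping.single a 1))"
  by (simp flip: lder_linear(3))

lemma lder_left_tens: "lder_left i (tens x y) = tens (lder i x) y"
proof (induction x rule: poly_mapping_induct)
  case (single a c)
  show ?case
  proof (induction y rule: poly_mapping_induct)
    case (single b d)
    have "Poly_Mapping.single b d = scal d (Poly_Mapping.single b 1)" by simp
    then show ?case
      by (simp add: tens_single lder_left_def lder_single[of _ _ c] mult_ac del: scal_simps(6))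
  qed (simp_all add: lder_left_def)
qed (simp_all add: lder_left_def)

text \<open>Coassociativity again: both sides are what follows \<open>theta i\<close> in the
  iterated coproduct of x.\<close>

lemma coprod_lder: "coprod \<Omega> (lder i x) = lder_left i (coprod \<Omega> x)"
proof (induction x rule: falg_induct)
  case one
  show ?case using coprod_scal[of \<Omega> 0 1] by (simp add: coprod_one lder_left_tens)
next
  case (theta j x)
  have 1: "lder_left i (tmult \<Omega> (tens (theta j) 1) X) =
     scal (of_bool (i = j)) X + scal (q j i) (tmult \<Omega> (tens (theta j) 1) (lder_left i X))" for X
    by (induction X rule: falg2_induct) (simp_all add: lder_left_tens tmult_theta_tens algebra_simps)
  have 2: "lder_left i (tmult \<Omega> (tens 1 (theta j)) X) =
     scal (q j i) (tmult \<Omega> (tens 1 (theta j)) (lder_left i X))" for X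
    by (induction X rule: falg2_induct) (simp_all add: lder_left_tens tmult_theta_tens algebra_simps)
  show ?case
    by (simp add: coprod_theta_mult 1 2 coprod_add coprod_scal theta.IH)
qed (simp_all add: coprod_add coprod_scal)

lemma counit_coprod: "counit_left (coprod \<Omega> x) = x" "counit_right (coprod \<Omega> x) = x"
proof -
  have "counit_left (tmult \<Omega> (tens (theta j) 1) X) = 0"
    "counit_left (tmult \<Omega> (tens 1 (theta j)) X) = theta j * counit_left X"
    "counit_right (tmult \<Omega> (tens (theta j) 1) X) = theta j * counit_right X"
    "counit_right (tmult \<Omega> (tens 1 (theta j)) X) = 0" for j X
    by (induction X rule: falg2_induct)
       (simp_all add: tmult_theta_tens counit_tens distrib_left eps_wdiag)
  then have "counit_left (coprod \<Omega> x) = x \<and> counit_right (coprod \<Omega> x) = x"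
    by (induction x rule: falg_induct)
       (simp_all add: coprod_one coprod_theta_mult coprod_add coprod_scal counit_tens)
  then show "counit_left (coprod \<Omega> x) = x" "counit_right (coprod \<Omega> x) = x" by blast+
qed

lemma linear_form_bform [simp]: "linear_form (bform x)" "linear_form (\<lambda>x. bform x y)"
  by (simp_all add: linear_scal_iff)

lemma pair_theta_mult:
  assumes "linear_form g"
  shows "pair (bform (theta i * x)) g X = theta_norm i * pair (bform (om i x)) g (lder_left i X)"
  by (induction X rule: falg2_induct)
     (simp_all add: pair_tens assms lder_left_tens distrib_left, simp add: bform_theta_mult)

lemma pair_bform_scal: "pair (bform (scal c x)) g X = c * pair (bform x) g X"
  by (simp add: pair_def linfun_def sum_distrib_left mult_ac)

abbreviation mon :: "'i fmon \<Rightarrow> 'i falg" where "mon w \<equiv> Poly_Mapping.single w 1"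

lemma fmon_induct [case_names zero letter]:
  assumes "P 0" "\<And>i w. P w \<Longrightarrow> P (FMon [i] + w)"
  shows "P (w :: 'i fmon)"
proof -
  have "P (FMon l)" for l
    by (induction l) (use assms in \<open>force simp: zero_fmon_def plus_fmon_def\<close>)+
  from this[of "letters w"] show ?thesis by simp
qed

lemma mon_add: "mon (u + v) = mon u * mon v" and mon_zero: "mon 0 = 1" and mon_letter: "mon (FMon [i]) = theta i"
  by (simp_all add: mult_single theta_def)

text \<open>Monomials have definite weights, so the twist of the tensor square is a single scalar
  here. Peeling letters off \<open>u\<close> transfers \<open>lder i\<close> to the first tensor
  factor of the coproduct.\<close>

lemma bform_mon_mult:
  "bform (mon u * mon v) y = twist (weight u) (weight v) * pair (bform (mon u)) (bform (mon v)) (coprod \<Omega> y)"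
proof (induction u arbitrary: y rule: fmon_induct)
  case zero
  have eps: "linear_form eps" by (simp add: linear_scal_iff)
  have "pair eps g X = g (counit_left X)" if g: "linear_form g" for g X
    by (induction X rule: falg2_induct)
       (simp_all add: pair_tens eps g counit_tens linear_form_simps[OF g])
  from this[of "bform (mon v)" "coprod \<Omega> y"] show ?case by (simp add: mon_zero counit_coprod)
next
  case (letter i u)
  have om: "om i (mon w) = scal (twist (simple i) (weight w)) (mon w)" for w
    by (simp add: wdiag_def)
  have "bform (mon (FMon [i] + u) * mon v) y = theta_norm i * bform (om i (mon (u + v))) (lder i y)"
    by (simp add: mon_add mon_letter mult.assoc bform_theta_mult)
  also have "\<dots> = theta_norm i * twist (simple i) (weight u) * twist (simple i) (weight v) *
      bform (mon u * mon v) (lder i y)"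
    by (subst om) (simp add: twist_add mon_add)
  also have "\<dots> = theta_norm i * twist (simple i) (weight u) * twist (simple i) (weight v) *
      twist (weight u) (weight v) * pair (bform (mon u)) (bform (mon v)) (lder_left i (coprod \<Omega> y))"
    by (simp add: letter.IH coprod_lder)
  also have "\<dots> = twist (weight (FMon [i] + u)) (weight v) *
       (theta_norm i * pair (bform (om i (mon u))) (bform (mon v)) (lder_left i (coprod \<Omega> y)))"
    unfolding om pair_bform_scal by (simp add: twist_add weight_letter mult_ac)
  also have "\<dots> = twist (weight (FMon [i] + u)) (weight v) *
       pair (bform (mon (FMon [i] + u))) (bform (mon v)) (coprod \<Omega> y)"
    by (simp add: mon_add mon_letter pair_theta_mult)
  finally show ?case .
qed

lemma tform_eq_linfun: "tform \<Omega> B X Y = linfun (\<lambda>p. twist (weight (fst p)) (weight (snd p)) *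
    pair (B (mon (fst p))) (B (mon (snd p))) Y) X"
  by (simp add: tform_def linfun_def pair_def twist_def sum_distrib_left case_prod_unfold mult_ac)

lemma tform_linear [simp]:
  "tform \<Omega> B (X + X') Y = tform \<Omega> B X Y + tform \<Omega> B X' Y"
  "tform \<Omega> B (scal c X) Y = c * tform \<Omega> B X Y"
  "tform \<Omega> B X (Y + Y') = tform \<Omega> B X Y + tform \<Omega> B X Y'"
  "tform \<Omega> B X (scal c Y) = c * tform \<Omega> B X Y"
  "tform \<Omega> B 0 Y = 0" "tform \<Omega> B X 0 = 0"
proof -
  have "linfun (\<lambda>a. f a * (c * g a)) X = c * linfun (\<lambda>a. f a * g a) X" for f g :: "_ \<Rightarrow> qvt" and X
    by (simp add: linfun_def sum_distrib_left mult_ac)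
  moreover have "linfun (\<lambda>a. 0) X = 0" for X :: "'i falg2"
    by (simp add: linfun_def)
  ultimately show "tform \<Omega> B (X + X') Y = tform \<Omega> B X Y + tform \<Omega> B X' Y"
    "tform \<Omega> B (scal c X) Y = c * tform \<Omega> B X Y"
    "tform \<Omega> B X (Y + Y') = tform \<Omega> B X Y + tform \<Omega> B X Y'"
    "tform \<Omega> B X (scal c Y) = c * tform \<Omega> B X Y"
    "tform \<Omega> B 0 Y = 0" "tform \<Omega> B X 0 = 0"
    by (simp_all add: tform_eq_linfun distrib_left linfun_fun_add)
qed

lemma tform_single_left:
  "tform \<Omega> B (Poly_Mapping.single (u, v) 1) Y = twist (weight u) (weight v) * pair (B (mon u)) (B (mon v)) Y"
  by (simp add: tform_eq_linfun)

lemma bform_mult: "bform (x * y) z = tform \<Omega> bform (tens x y) (coprod \<Omega> z)"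
proof (induction x rule: poly_mapping_induct)
  case (single a c)
  show ?case
  proof (induction y rule: poly_mapping_induct)
    case (single b d)
    have "Poly_Mapping.single a c * Poly_Mapping.single b d = scal (c * d) (mon a * mon b)"
      by (simp add: mult_single)
    moreover have "tens (Poly_Mapping.single a c) (Poly_Mapping.single b d) =
        scal (c * d) (Poly_Mapping.single (a, b) 1)"
      by (simp add: tens_single)
    ultimately show ?case by (simp only: bform_scal_left tform_linear tform_single_left bform_mon_mult)
  qed (simp_all add: distrib_left)
qed (simp_all add: distrib_right)

lemma bform_mon_eq_0:
  assumes "weight u \<noteq> weight w"
  shows "bform (mon u) (mon w) = 0"
  using bform_wdiag[of "\<lambda>\<beta>. of_bool (\<beta> = weight u)" "mon u" "mon w"] assms
  by (auto simp: wdiag_def)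

text \<open>The twist in \<open>tform\<close> reads only the weights of its left argument; it is
  symmetric because terms with different weights on the two sides pair to zero.\<close>

lemma tform_bform_commute: "tform \<Omega> bform X Y = tform \<Omega> bform Y X"
proof (induction X rule: poly_mapping_induct)
  case (single p c)
  show ?case
  proof (induction Y rule: poly_mapping_induct)
    case (single r d)
    obtain a b a' b' where [simp]: "p = (a, b)" "r = (a', b')" by fastforce
    have comm: "bform (mon a') (mon a) = bform (mon a) (mon a')" "bform (mon b') (mon b) = bform (mon b) (mon b')"
      by (rule bform_commute)+
    have "bform (mon a) (mon a') = 0 \<or> bform (mon b) (mon b') = 0 \<or>
      weight a = weight a' \<and> weight b = weight b'"
      using bform_mon_eq_0 by blast
    then show ?case
      by (auto simp: tform_eq_linfun pair_single comm mult_ac)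
  qed simp_all
qed simp_all

lemma bform_theta: "bform (theta i) y = theta_norm i * eps (lder i y)"
  using bform_theta_mult[of i 1 y] by simp

lemma is_form_bform: "is_form \<Omega> bform"
  unfolding is_form_def
  by (auto simp: bform_mult theta_norm_def bform_theta bform_commute[of _ "_ * _"] intro: tform_bform_commute)
     (auto simp: bform_commute)

lemma tform_tens:
  assumes "\<And>x. linear_form (B x)"
  shows "tform \<Omega> B (Poly_Mapping.single (u, v) 1) (tens x y) =
     twist (weight u) (weight v) * (B (mon u) x * B (mon v) y)"
  by (simp add: tform_single_left pair_tens assms)

text \<open>A form obeying the axioms satisfies the recursion that defines
  \<open>bform_word\<close>, once its values against 1 and the generators are known.\<close>

lemma is_form_unique:
  assumes "is_form \<Omega> B"
  shows "B = bform"
proof -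
  from assms have linl: "linear_form (\<lambda>x. B x y)" and lin: "linear_form (B x)"
    and comm: "B x y = B y x" and one: "B 1 1 = 1"
    and thetas: "B (theta i) (theta j) = of_bool (i = j) * theta_norm i"
    and multr: "B x (y * z) = tform \<Omega> B (coprod \<Omega> x) (tens y z)"
    and multl: "B (y * z) x = tform \<Omega> B (tens y z) (coprod \<Omega> x)" for x y z i j
    unfolding is_form_def theta_norm_def by blast+
  note simps = linear_form_simps[OF lin] linear_form_simps[OF linl]
  have mons: "1 = mon 0" "theta i = mon (FMon [i])" for i
    by (simp_all add: theta_def)
  have tt: "tform \<Omega> B (tens 1 1) (tens x y) = B 1 x * B 1 y"
    "tform \<Omega> B (tens (theta i) 1) (tens x y) = B (theta i) x * B 1 y"
    "tform \<Omega> B (tens 1 (theta i)) (tens x y) = B 1 x * B (theta i) y" for i x y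
    unfolding mons by (simp_all add: tens_single tform_tens[OF lin] del: single_one)
  \<comment> \<open>The axioms do not state this value. Expanding (theta j, 1 * theta j) through the
    coproduct of \<open>theta j\<close> and cancelling (theta j, theta j) leaves that its square is
    0.\<close>
  have one_theta: "B 1 (theta j) = 0" for j
  proof -
    have "B (theta j) (1 * theta j) = B (theta j) 1 * B 1 (theta j) + B 1 1 * B (theta j) (theta j)"
      unfolding multr by (simp add: coprod_theta tt)
    then show ?thesis by (simp add: one comm[of "theta j" 1])
  qed
  have B1: "B 1 y = eps y" for y
  proof (induction y rule: falg_induct)
    case (theta j y)
    show ?case by (simp add: multr coprod_one tt one_theta)
  qed (simp_all add: simps one)
  have Btheta: "B (theta i) y = theta_norm i * eps (lder i y)" for i y
  proof (induction y rule: falg_induct)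
    case one
    show ?case by (simp add: comm[of _ 1] one_theta)
  next
    case (theta j y)
    show ?case by (simp add: multr coprod_theta tt thetas B1)
  qed (simp_all add: simps algebra_simps)
  have "B (mon w) y = bform (mon w) y" for w y
  proof (induction w arbitrary: y rule: fmon_induct)
    case zero
    show ?case by (simp add: mon_zero B1)
  next
    case (letter i w)
    have 1: "pair (B (theta i)) (B (mon w)) X = theta_norm i * B (mon w) (counit_left (lder_left i X))" for X
      by (induction X rule: falg2_induct)
         (simp_all add: pair_tens lin lder_left_tens counit_tens simps distrib_left, simp add: Btheta)
    have 2: "tens (theta i) (mon w) = Poly_Mapping.single (FMon [i], w) 1"
      by (simp add: theta_def tens_single)
    have "B (mon (FMon [i] + w)) y =
        twist (weight (FMon [i])) (weight w) * pair (B (mon (FMon [i]))) (B (mon w)) (coprod \<Omega> y)"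
      by (simp only: mon_add mon_letter multl 2 tform_single_left)
    also have "\<dots> = twist (simple i) (weight w) * theta_norm i * B (mon w) (lder i y)"
      by (simp only: mon_letter weight_letter 1 counit_coprod mult.assoc flip: coprod_lder)
    finally have "B (mon (FMon [i] + w)) y = twist (simple i) (weight w) * theta_norm i * B (mon w) (lder i y)" .
    moreover have "bform (mon (FMon [i] + w)) y = twist (simple i) (weight w) * theta_norm i * bform (mon w) (lder i y)"
      unfolding mon_add mon_letter bform_theta_mult by (simp add: wdiag_def bform_single mult_ac)
    ultimately show ?case by (simp add: letter.IH)
  qed
  note mon_eq = this
  have "B x y = bform x y" for x y
  proof (induction x rule: poly_mapping_induct)
    case (single a c)
    show ?case using mon_eq[of a y] linear_form_single[OF linl, of a c y] by (simp add: bform_single)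
  qed (simp_all add: simps)
  then show ?thesis by blast
qed

lemma the_form_eq_bform: "the_form \<Omega> = bform"
  unfolding the_form_def using is_form_bform is_form_unique by (rule the_equality)

end

section \<open>Length filtration, weights and the antipode\<close>

lemma poly_mapping_induct_on [consumes 1, case_names zero single add]:
  fixes x :: "'a \<Rightarrow>\<^sub>0 'b::comm_monoid_add"
  assumes "Poly_Mapping.keys x \<subseteq> A"
    and zero: "P 0"
    and single: "\<And>a c. a \<in> A \<Longrightarrow> P (Poly_Mapping.single a c)"
    and add: "\<And>x y. P x \<Longrightarrow> P y \<Longrightarrow> P (x + y)"
  shows "P x"
proof -
  have "finite B \<Longrightarrow> B \<subseteq> A \<Longrightarrow> P (\<Sum>a\<in>B. Poly_Mapping.single a (Poly_Mapping.lookup x a))" for B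
    by (induction B rule: finite_induct) (auto simp: zero intro!: single add)
  moreover have "(\<Sum>a\<in>Poly_Mapping.keys x. Poly_Mapping.single a (Poly_Mapping.lookup x a)) = x"
    by (rule poly_mapping_eqI) (simp add: lookup_sum lookup_single when_def in_keys_iff)
  ultimately show ?thesis
    using assms(1) by (metis finite_keys)
qed

text \<open>The strict bound makes \<open>len_less 0\<close> the zero space, so inductions on length
  start trivially.\<close>

definition len_less :: "nat \<Rightarrow> 'i falg set" where
  "len_less n = {x. Poly_Mapping.keys x \<subseteq> {w. length (letters w) < n}}"

lemma len_less_closed [simp]: "0 \<in> len_less n" "x \<in> len_less n \<Longrightarrow> y \<in> len_less n \<Longrightarrow> x + y \<in> len_less n"
  "x \<in> len_less n \<Longrightarrow> scal c x \<in> len_less n" "x \<in> len_less n \<Longrightarrow> - x \<in> len_less n" "x \<in> len_less n \<Longrightarrow> wdiag f x \<in> len_less n"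
  using keys_add[of x y] by (auto simp: len_less_def in_keys_iff lookup_wdiag)

lemma len_less_0: "x \<in> len_less 0 \<longleftrightarrow> x = 0"
  by (simp add: len_less_def)

lemma len_less_single: "length (letters w) < n \<Longrightarrow> Poly_Mapping.single w c \<in> len_less n"
  by (auto simp: len_less_def)

lemma len_less_exists: "\<exists>n. x \<in> len_less n"
proof -
  have "finite ((length \<circ> letters) ` Poly_Mapping.keys x)" by simp
  then obtain n where "\<forall>m \<in> (length \<circ> letters) ` Poly_Mapping.keys x. m < n"
    using finite_nat_set_iff_bounded by metis
  then have "x \<in> len_less n" by (auto simp: len_less_def)
  then show ?thesis ..
qed

lemma len_less_induct [consumes 1, case_names zero single add]:
  assumes "x \<in> len_less n" "P 0" "\<And>w c. length (letters w) < n \<Longrightarrow> P (Poly_Mapping.single w c)"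
    "\<And>x y. P x \<Longrightarrow> P y \<Longrightarrow> P (x + y)"
  shows "P x"
  by (rule poly_mapping_induct_on[of x "{w. length (letters w) < n}"])
     (use assms in \<open>simp_all add: len_less_def\<close>)

lemma len_less_theta_mult: "x \<in> len_less n \<Longrightarrow> theta i * x \<in> len_less (Suc n)"
  by (induction x rule: len_less_induct)
     (simp_all add: theta_def mult_single plus_fmon_def distrib_left len_less_single)

lemma len_less_mult_theta: "x \<in> len_less n \<Longrightarrow> x * theta i \<in> len_less (Suc n)"
  by (induction x rule: len_less_induct)
     (simp_all add: theta_def mult_single plus_fmon_def distrib_right len_less_single)

lemma len_less_Suc: "x \<in> len_less n \<Longrightarrow> x \<in> len_less (Suc n)"
  by (auto simp: len_less_def)

definition homogeneous :: "('i \<Rightarrow> int) \<Rightarrow> 'i falg \<Rightarrow> bool" where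
  "homogeneous \<beta> x \<longleftrightarrow> wdiag (\<lambda>\<gamma>. of_bool (\<gamma> = \<beta>)) x = x"

lemma homogeneous_wdiag: "homogeneous \<beta> x \<Longrightarrow> wdiag f x = scal (f \<beta>) x"
proof -
  assume "homogeneous \<beta> x"
  then have "wdiag f x = wdiag (\<lambda>\<gamma>. f \<gamma> * of_bool (\<gamma> = \<beta>)) x"
    by (metis homogeneous_def wdiag_wdiag)
  also have "(\<lambda>\<gamma>. f \<gamma> * of_bool (\<gamma> = \<beta>)) = (\<lambda>\<gamma>. f \<beta> * of_bool (\<gamma> = \<beta>))"
    by auto
  finally show ?thesis using \<open>homogeneous \<beta> x\<close> by (simp add: wdiag_cmult homogeneous_def)
qed

lemma homogeneous_proj: "homogeneous \<beta> (wdiag (\<lambda>\<gamma>. of_bool (\<gamma> = \<beta>)) x)"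
  by (simp add: homogeneous_def wdiag_wdiag flip: of_bool_conj)

lemma homogeneous_keys: "homogeneous \<beta> x \<Longrightarrow> w \<in> Poly_Mapping.keys x \<Longrightarrow> weight w = \<beta>"
  using lookup_wdiag[of "\<lambda>\<gamma>. of_bool (\<gamma> = \<beta>)" x w]
  by (auto simp: homogeneous_def in_keys_iff of_bool_def split: if_splits)

lemma sum_homogeneous_components: "(\<Sum>\<beta>\<in>weight ` Poly_Mapping.keys x. wdiag (\<lambda>\<gamma>. of_bool (\<gamma> = \<beta>)) x) = x"
proof (rule poly_mapping_eqI)
  fix w
  have "Poly_Mapping.lookup (\<Sum>\<beta>\<in>weight ` Poly_Mapping.keys x. wdiag (\<lambda>\<gamma>. of_bool (\<gamma> = \<beta>)) x) w =
     (\<Sum>\<beta>\<in>weight ` Poly_Mapping.keys x. if \<beta> = weight w then Poly_Mapping.lookup x w else 0)"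
    unfolding lookup_sum lookup_wdiag by (intro sum.cong) auto
  then show "Poly_Mapping.lookup (\<Sum>\<beta>\<in>weight ` Poly_Mapping.keys x. wdiag (\<lambda>\<gamma>. of_bool (\<gamma> = \<beta>)) x) w =
     Poly_Mapping.lookup x w"
    by (auto simp: in_keys_iff)
qed

lemma wdiag_mult_theta: "wdiag f (x * theta i) = wdiag (shift i f) x * theta i"
  by (induction x rule: poly_mapping_induct)
     (simp_all add: wdiag_def theta_def mult_single distrib_right shift_def weight_letter add.commute)

lemma vv_power_eq_one: "vv ^ n = 1 \<longleftrightarrow> n = 0"
proof -
  have to_fract_power: "to_fract (a ^ n) = to_fract a ^ n" for a :: "rat poly poly"
    by (induction n) simp_all
  have "vv ^ n = to_fract ([:[:0, 1:]:] ^ n)"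
    unfolding vv_def to_fract_power[symmetric] ..
  also have "[:[:0, 1:]:] ^ n = [:[:0, 1:] ^ n :: rat poly:]"
    by (induction n) (simp_all add: one_pCons)
  finally have "vv ^ n = to_fract [:[:0, 1:] ^ n:]" .
  then have "vv ^ n = 1 \<longleftrightarrow> [:[:0, 1:] ^ n:] = (1 :: rat poly poly)"
    by (simp flip: to_fract_1)
  also have "\<dots> \<longleftrightarrow> [:0, 1:] ^ n = (1 :: rat poly)"
    by (simp add: one_pCons)
  also have "\<dots> \<longleftrightarrow> n = 0"
  proof
    assume "[:0, 1:] ^ n = (1 :: rat poly)"
    then have "degree ([:0, 1:] ^ n :: rat poly) = 0" by simp
    then show "n = 0" by (simp add: degree_power_eq)
  qed simp
  finally show ?thesis .
qed

lemma vv_powi_eq_one: "vv powi k = 1 \<longleftrightarrow> k = 0"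
  by (cases k rule: int_cases4) (auto simp: power_int_minus vv_power_eq_one)

text \<open>The reduced coproduct is obtained by applying this to a coproduct.\<close>

definition middle :: "'i falg2 \<Rightarrow> 'i falg2" where
  "middle = linext (\<lambda>p. if fst p \<noteq> 0 \<and> snd p \<noteq> 0 then Poly_Mapping.single p 1 else 0)"

lemma middle_linear [simp]:
  "middle (X + Y) = middle X + middle Y" "middle (scal c X) = scal c (middle X)" "middle 0 = 0"
  by (simp_all add: middle_def)

text \<open>The 1 \<otimes> 1 component occurs in both counit parts and is therefore subtracted
  once.\<close>

lemma middle_decomp: "X = middle X + tens 1 (counit_left X) + tens (counit_right X) 1 -
   scal (eps (counit_left X)) (tens 1 1)"
proof (induction X rule: poly_mapping_induct)
  case (single p c)
  obtain a b where [simp]: "p = (a, b)" by (cases p)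
  have eps: "eps (Poly_Mapping.single w d) = (if w = 0 then d else 0)" for w :: "'a fmon" and d
    by (simp add: eps_def lookup_single when_def)
  show ?case
    by (auto simp: middle_def counit_left_def counit_right_def eps tens_single_one tens_one_one single_diff
        simp flip: single_add)
next
  case (sum X Y)
  let ?R = "\<lambda>X. middle X + tens 1 (counit_left X) + tens (counit_right X) 1 -
     scal (eps (counit_left X)) (tens 1 1)"
  have "?R (X + Y) = ?R X + ?R Y" by (simp add: scal_add_left)
  then show ?case using sum by simp
qed simp

lemma lookup_middle: "Poly_Mapping.lookup (middle X) (a, b) = (if a \<noteq> 0 \<and> b \<noteq> 0 then Poly_Mapping.lookup X (a, b) else 0)"
  by (induction X rule: poly_mapping_induct)
     (auto simp: middle_def lookup_add lookup_single when_def)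

definition total_len_less :: "nat \<Rightarrow> 'i falg2 set" where
  "total_len_less n = {X. Poly_Mapping.keys X \<subseteq> {p. length (letters (fst p)) + length (letters (snd p)) < n}}"

lemma total_len_less_closed [simp]: "0 \<in> total_len_less n" "X \<in> total_len_less n \<Longrightarrow> Y \<in> total_len_less n \<Longrightarrow> X + Y \<in> total_len_less n"
  "X \<in> total_len_less n \<Longrightarrow> scal c X \<in> total_len_less n"
  using keys_add[of X Y] by (auto simp: total_len_less_def in_keys_iff)

lemma total_len_less_induct [consumes 1, case_names zero single add]:
  assumes "X \<in> total_len_less n" "P 0"
    "\<And>a b c. length (letters a) + length (letters b) < n \<Longrightarrow> P (Poly_Mapping.single (a, b) c)"
    "\<And>X Y. P X \<Longrightarrow> P Y \<Longrightarrow> P (X + Y)"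
  shows "P X"
  by (rule poly_mapping_induct_on[of X "{p. length (letters (fst p)) + length (letters (snd p)) < n}"])
     (use assms in \<open>simp_all add: total_len_less_def split_paired_all\<close>)

context twisted_form
begin

lemma len_less_lder: "x \<in> len_less (Suc n) \<Longrightarrow> lder i x \<in> len_less n"
proof (induction x rule: len_less_induct)
  case (single w c)
  have "lder_word i l \<in> len_less (length l)" for l
    by (induction l) (auto intro!: len_less_theta_mult len_less_closed intro: len_less_single)
  from this[of "letters w"] have "lder_word i (letters w) \<in> len_less n"
    using single by (auto simp: len_less_def)
  then show ?case by (simp add: lder_def)
qed simp_all

lemma len_less_rder: "x \<in> len_less (Suc n) \<Longrightarrow> rder i x \<in> len_less n"
proof (induction x rule: len_less_induct)
  case (single w c)
  have "rder_word i l \<in> len_less (length l)" for l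
    by (induction l) (auto intro!: len_less_theta_mult len_less_closed intro: len_less_single)
  from this[of "letters w"] have "rder_word i (letters w) \<in> len_less n"
    using single by (auto simp: len_less_def)
  then show ?case by (simp add: rder_def)
qed simp_all

lemma total_len_less_coprod: "x \<in> len_less n \<Longrightarrow> coprod \<Omega> x \<in> total_len_less n"
proof (induction x rule: len_less_induct)
  case zero
  show ?case using coprod_scal[of \<Omega> 0 0] by simp
next
  case (single w c)
  have 1: "tmult \<Omega> (tens (theta i) 1 + tens 1 (theta i)) X \<in> total_len_less (Suc k)" if "X \<in> total_len_less k" for i X k
    using that
  proof (induction X rule: total_len_less_induct)
    case (single a b c)
    then show ?case
      unfolding theta_def tens_single_one tmult_add_left
      by (intro total_len_less_closed) (auto simp: tmult_single total_len_less_def plus_fmon_def zero_fmon_def)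
  qed (simp_all del: tmult_add_left)
  have 0: "tens 1 1 \<in> total_len_less (Suc 0)"
    by (simp add: tens_one_one total_len_less_def zero_fmon_def)
  have "coprod_word \<Omega> l \<in> total_len_less (Suc (length l))" for l
    by (induction l) (simp_all add: 0 1 del: tmult_add_left)
  from this[of "letters w"] single have "coprod_word \<Omega> (letters w) \<in> total_len_less n"
    by (auto simp: total_len_less_def)
  then show ?case by (simp add: coprod_def)
qed (simp add: coprod_add)

section \<open>The radical is a two-sided ideal\<close>

definition rad :: "'i falg set" where "rad = {x. \<forall>y. bform y x = 0}"

lemma form_radical_eq_rad: "form_radical (the_form \<Omega>) = rad"
  by (auto simp: form_radical_def the_form_eq_bform rad_def bform_commute)

lemma rad_closed [simp]: "0 \<in> rad" "x \<in> rad \<Longrightarrow> y \<in> rad \<Longrightarrow> x + y \<in> rad"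
  "x \<in> rad \<Longrightarrow> scal c x \<in> rad" "x \<in> rad \<Longrightarrow> wdiag f x \<in> rad"
  by (simp_all add: rad_def flip: bform_wdiag)

lemma rad_uminus [simp]: "x \<in> rad \<Longrightarrow> - x \<in> rad"
  using rad_closed(3)[of x "-1"] by simp

lemma rad_eps: "x \<in> rad \<Longrightarrow> eps x = 0"
  by (metis (mono_tags, lifting) bform_one mem_Collect_eq rad_def)

lemma rad_mult_left: "x \<in> rad \<Longrightarrow> a * x \<in> rad"
proof (induction a rule: falg_induct)
  case (theta i a)
  then have "om i (a * x) \<in> rad" by simp
  then have "bform (om i (a * x)) y = 0" for y
    by (simp add: rad_def bform_commute[of "om i (a * x)"])
  then have "bform y (theta i * (a * x)) = 0" for y
    by (simp add: bform_commute[of y] bform_theta_mult)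
  then show ?case by (simp add: rad_def mult.assoc)
qed (simp_all add: distrib_right)

lemma rad_mult_right: "x \<in> rad \<Longrightarrow> x * a \<in> rad"
proof (induction a arbitrary: x rule: falg_induct)
  case (theta i a)
  then have "om' i x \<in> rad" by simp
  then have "bform (om' i x) y = 0" for y
    by (simp add: rad_def bform_commute[of "om' i x"])
  then have "bform y (x * theta i) = 0" for y
    by (simp add: bform_commute[of y] bform_mult_theta)
  then have "x * theta i \<in> rad" by (simp add: rad_def)
  from theta.IH[OF this] show ?case by (simp add: mult.assoc)
qed (simp_all add: distrib_left)

lemma two_sided_ideal_rad: "two_sided_ideal rad"
  by (simp add: two_sided_ideal_def rad_mult_left rad_mult_right)

section \<open>The braided antipode\<close>

primrec antipode_word :: "'i list \<Rightarrow> 'i falg" where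
  "antipode_word [] = 1"
| "antipode_word (i # w) = scal (- chi (simple i) (weight (FMon w))) (antipode_word w * theta i)"

definition antipode :: "'i falg \<Rightarrow> 'i falg" where
  "antipode = linext (\<lambda>w. antipode_word (letters w))"

lemma antipode_linear [simp]: "antipode 0 = 0" "antipode (x + y) = antipode x + antipode y"
  "antipode (scal c x) = scal c (antipode x)" "antipode (x - y) = antipode x - antipode y" "antipode (- x) = - antipode x"
  by (simp_all add: antipode_def)

lemma antipode_one [simp]: "antipode 1 = 1"
  by (simp add: antipode_def zero_fmon_def flip: single_one)

text \<open>Braided anti-multiplicativity: reversing a product applies the braiding, and the sign is
  that of a primitive generator.\<close>

lemma antipode_theta_mult: "antipode (theta i * x) = - (antipode (tau i x) * theta i)"
  by (induction x rule: poly_mapping_induct)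
     (simp_all add: antipode_def theta_def mult_single plus_fmon_def distrib_left distrib_right wdiag_def)

lemma antipode_theta [simp]: "antipode (theta i) = - theta i"
  using antipode_theta_mult[of i 1] by simp

lemma antipode_wdiag: "antipode (wdiag f x) = wdiag f (antipode x)"
  by (induction x arbitrary: f rule: falg_induct)
     (simp_all add: antipode_theta_mult wdiag_theta_mult wdiag_mult_theta wdiag_wdiag mult.commute)

lemma eps_mult_theta [simp]: "eps (x * theta i) = 0"
  by (induction x rule: falg_induct) (simp_all add: distrib_right mult.assoc)

lemma eps_antipode: "eps (antipode x) = eps x"
  by (induction x rule: falg_induct) (simp_all add: antipode_theta_mult)

text \<open>Reversal of words exchanges left and right derivations; by induction on length this
  carries the radical into itself.\<close>

lemma lder_antipode: "lder i (antipode x) = - antipode (sig i (rder i x))"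
  by (induction x rule: falg_induct)
     (simp_all add: antipode_theta_mult lder_mult antipode_wdiag wdiag_commute[of "chi _"] algebra_simps)

lemma len_less_antipode: "x \<in> len_less n \<Longrightarrow> antipode x \<in> len_less n"
proof (induction x rule: len_less_induct)
  case (single w c)
  have 1: "1 \<in> len_less (Suc 0)"
    by (simp add: len_less_def zero_fmon_def)
  have "antipode_word l \<in> len_less (Suc (length l))" for l
    by (induction l) (simp_all add: 1 len_less_mult_theta)
  from this[of "letters w"] have "antipode_word (letters w) \<in> len_less n"
    using single by (auto simp: len_less_def)
  then show ?case by (simp add: antipode_def)
qed simp_all

lemma antipode_mult_theta: "antipode (x * theta i) = - (theta i * antipode (sig i x))"
proof (induction x rule: falg_induct)
  case (theta k x)
  have "antipode (theta k * x * theta i) = - (tau k (antipode (x * theta i)) * theta k)"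
    by (simp add: antipode_theta_mult antipode_wdiag mult.assoc)
  also have "\<dots> = - (theta i * antipode (sig i (theta k * x)))"
    by (simp add: theta.IH antipode_theta_mult antipode_wdiag wdiag_commute[of "chi _"] mult.assoc)
  finally show ?case .
qed (simp_all add: algebra_simps)

text \<open>The exponent is 2(rho, \<beta>) - (\<beta>, \<beta>) with 2(rho, i) = i \<cdot> i; it
  vanishes on simple weights, as it must for primitive generators.\<close>

definition antipode_sq :: "('i \<Rightarrow> int) \<Rightarrow> qvt" where
  "antipode_sq \<beta> = vv powi ((\<Sum>i\<in>UNIV. \<beta> i * (2 * \<Omega> i i)) - dot \<Omega> \<beta> \<beta>)"

lemma sum_simple: "(\<Sum>k\<in>UNIV. simple i k * f k) = f i" for f :: "'i \<Rightarrow> int"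
proof -
  have "(\<Sum>k\<in>UNIV. simple i k * f k) = (\<Sum>k\<in>UNIV. if k = i then f k else 0)"
    by (intro sum.cong) (auto simp: simple_def)
  then show ?thesis by (simp add: sum.delta)
qed

lemma chi_swap: "chi \<alpha> \<beta> * chi \<beta> \<alpha> = vv powi (- 2 * dot \<Omega> \<alpha> \<beta>)"
proof -
  have "dot \<Omega> \<beta> \<alpha> = dot \<Omega> \<alpha> \<beta>" by (simp add: dot_def)
  then have "chi \<alpha> \<beta> * chi \<beta> \<alpha> = (vv powi (- dot \<Omega> \<alpha> \<beta>) * vv powi (- dot \<Omega> \<alpha> \<beta>)) *
     (tt powi (ang \<Omega> \<beta> \<alpha> - ang \<Omega> \<alpha> \<beta>) * tt powi (ang \<Omega> \<alpha> \<beta> - ang \<Omega> \<beta> \<alpha>))"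
    by (simp add: chi_def mult_ac)
  also have "\<dots> = vv powi (- 2 * dot \<Omega> \<alpha> \<beta>)"
    by (simp flip: power_int_add)
  finally show ?thesis .
qed

lemma shift_antipode_sq: "shift i antipode_sq = (\<lambda>\<beta>. antipode_sq \<beta> * (chi \<beta> (simple i) * chi (simple i) \<beta>))"
proof
  fix \<beta>
  have "dot \<Omega> (\<lambda>k. simple i k + \<beta> k) (\<lambda>k. simple i k + \<beta> k) =
      2 * \<Omega> i i + 2 * dot \<Omega> \<beta> (simple i) + dot \<Omega> \<beta> \<beta>"
    by (simp add: dot_def ang_def bilin_simple)
  moreover have "(\<Sum>k\<in>UNIV. (simple i k + \<beta> k) * (2 * \<Omega> k k)) =
     2 * \<Omega> i i + (\<Sum>k\<in>UNIV. \<beta> k * (2 * \<Omega> k k))"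
    by (simp add: distrib_right sum.distrib sum_simple)
  ultimately have "shift i antipode_sq \<beta> = vv powi (((\<Sum>k\<in>UNIV. \<beta> k * (2 * \<Omega> k k)) - dot \<Omega> \<beta> \<beta>) +
      (- 2 * dot \<Omega> \<beta> (simple i)))"
    by (simp add: shift_def antipode_sq_def algebra_simps)
  then show "shift i antipode_sq \<beta> = antipode_sq \<beta> * (chi \<beta> (simple i) * chi (simple i) \<beta>)"
    by (simp add: chi_swap antipode_sq_def power_int_diff power_int_minus divide_inverse)
qed

text \<open>Two reversals restore the order of the letters, and each letter pays the double braiding
  with the letters after it. These factors are the increments of \<open>antipode_sq\<close>.\<close>

lemma antipode_antipode: "antipode (antipode x) = wdiag antipode_sq x"
proof (induction x rule: falg_induct)
  case one
  show ?case by (simp add: antipode_sq_def dot_def ang_def)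
next
  case (theta i x)
  have "antipode (antipode (theta i * x)) = theta i * sig i (tau i (antipode (antipode x)))"
    by (simp add: antipode_theta_mult antipode_mult_theta antipode_wdiag)
  also have "\<dots> = wdiag antipode_sq (theta i * x)"
    by (simp add: theta.IH wdiag_theta_mult shift_antipode_sq wdiag_wdiag mult_ac)
  finally show ?case .
qed simp_all

definition antipode_mult :: "'i falg2 \<Rightarrow> 'i falg" where
  "antipode_mult = linext (\<lambda>p. antipode (mon (fst p)) * mon (snd p))"

lemma antipode_mult_linear [simp]: "antipode_mult (X + Y) = antipode_mult X + antipode_mult Y"
  "antipode_mult (scal c X) = scal c (antipode_mult X)" "antipode_mult 0 = 0" "antipode_mult (X - Y) = antipode_mult X - antipode_mult Y"
  by (simp_all add: antipode_mult_def)

lemma antipode_mult_tens: "antipode_mult (tens x y) = antipode x * y"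
proof (induction x rule: poly_mapping_induct)
  case (single a c)
  have a: "antipode (Poly_Mapping.single a c) = scal c (antipode (mon a))"
    by (simp flip: antipode_linear(3))
  show ?case
  proof (induction y rule: poly_mapping_induct)
    case (single b d)
    have "Poly_Mapping.single b d = scal d (mon b)" by simp
    then show ?case
      by (simp add: a tens_single antipode_mult_def mult_ac del: scal_simps(6))
  qed (simp_all add: distrib_left)
qed (simp_all add: distrib_right)

text \<open>The antipode axiom. For a leading letter the contributions of theta i \<otimes> 1 and 1
  \<otimes> theta i cancel by \<open>antipode_theta_mult\<close>.\<close>

lemma antipode_mult_coprod: "antipode_mult (coprod \<Omega> x) = scal (eps x) 1"
proof (induction x rule: falg_induct)
  case (theta i x)
  have "antipode_mult (tmult \<Omega> (tens (theta i) 1) X) + antipode_mult (tmult \<Omega> (tens 1 (theta i)) X) = 0" for X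
  proof (induction X rule: falg2_induct)
    case (tens x y)
    show ?case by (simp add: tmult_theta_tens antipode_mult_tens antipode_theta_mult mult.assoc)
  next
    case (add X Y)
    then show ?case by (simp add: algebra_simps)
  qed
  then show ?case by (simp add: coprod_theta_mult)
qed (simp_all add: coprod_one coprod_add coprod_scal antipode_mult_tens scal_add_left)

lemma pair_rad:
  assumes "x \<in> rad"
  shows "pair (bform y) (bform z) (coprod \<Omega> x) = 0"
proof (induction y rule: poly_mapping_induct)
  case (single u c)
  show ?case
  proof (induction z rule: poly_mapping_induct)
    case (single v d)
    have "twist (weight u) (weight v) * pair (bform (mon u)) (bform (mon v)) (coprod \<Omega> x) = 0"
      using assms by (simp add: rad_def flip: bform_mon_mult)
    then have "pair (bform (mon u)) (bform (mon v)) (coprod \<Omega> x) = 0" by simp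
    moreover have "pair (bform (Poly_Mapping.single u c)) (bform (Poly_Mapping.single v d)) X =
        c * d * pair (bform (mon u)) (bform (mon v)) X" for X
      by (simp add: pair_def linfun_def bform_single sum_distrib_left mult_ac)
    ultimately show ?case by simp
  next
    case (sum z z')
    then show ?case by (simp add: pair_def distrib_left linfun_fun_add)
  qed (simp add: pair_def linfun_def)
next
  case (sum y y')
  then show ?case by (simp add: pair_def distrib_right linfun_fun_add)
qed (simp add: pair_def linfun_def)

end

section \<open>Braided adjoint action and the coideal property\<close>

lemma len_less_sum: "(\<And>a. a \<in> A \<Longrightarrow> f a \<in> len_less n) \<Longrightarrow> sum f A \<in> len_less n"
  by (induction A rule: infinite_finite_induct) simp_all

context twisted_form
begin

text \<open>A nonempty word pairs with x only through \<open>lder i x\<close>, where i is its first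
  letter.\<close>

lemma mem_radI:
  assumes "eps x = 0" "\<And>i. lder i x \<in> rad"
  shows "x \<in> rad"
proof -
  have "bform y x = 0" for y
    by (induction y rule: falg_induct) (use assms in \<open>simp_all add: bform_theta_mult rad_def\<close>)
  then show ?thesis by (simp add: rad_def)
qed

definition adj :: "'i \<Rightarrow> 'i falg \<Rightarrow> 'i falg" where
  "adj i x = theta i * x - tau i x * theta i"

lemma adj_linear [simp]: "adj i 0 = 0" "adj i (x + y) = adj i x + adj i y"
  "adj i (scal c x) = scal c (adj i x)" "adj i (x - y) = adj i x - adj i y"
  by (simp_all add: adj_def algebra_simps)

lemma adj_one [simp]: "adj i 1 = 0"
  by (simp add: adj_def)

lemma adj_mult: "adj i (x * y) = adj i x * y + tau i x * adj i y"
  by (simp add: adj_def wdiag_chi_mult algebra_simps)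

lemma wdiag_chi_adj:
  "wdiag (chi \<alpha>) (adj i x) = scal (chi \<alpha> (simple i)) (adj i (wdiag (chi \<alpha>) x))"
  "wdiag (\<lambda>\<beta>. chi \<beta> \<alpha>) (adj i x) = scal (chi (simple i) \<alpha>) (adj i (wdiag (\<lambda>\<beta>. chi \<beta> \<alpha>) x))"
  by (simp_all add: adj_def wdiag_chi_mult wdiag_commute[of "chi (simple i)"])

text \<open>Differentiating \<open>theta i\<close> in either product produces
  \<open>tau i x\<close>, and the two copies cancel.\<close>

lemma rder_adj:
  assumes "rder i x = 0"
  shows "rder i (adj i x) = 0"
  by (simp add: adj_def rder_mult assms)

text \<open>A quantum sl2 relation: \<open>lder i\<close> lowers, \<open>adj i\<close> raises, and
  the double braiding \<open>sig i\<close> after \<open>tau i\<close> plays the Cartan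
  element.\<close>

lemma lder_adj: "lder i (adj i x) = x - sig i (tau i x) + scal (q i i) (adj i (lder i x))"
  by (simp add: adj_def lder_mult algebra_simps)

lemma lder_adj_other: "k \<noteq> i \<Longrightarrow> lder k (adj i x) = scal (q i k) (adj i (lder k x))"
  by (simp add: adj_def lder_mult algebra_simps)

text \<open>The unbalanced quantum integer (1 - q^n)/(1 - q) at q = \<open>q i i\<close>.\<close>

definition qnum :: "'i \<Rightarrow> nat \<Rightarrow> qvt" where
  "qnum i n = (\<Sum>k<n. q i i ^ k)"

lemma tau_theta_power: "tau i (theta i ^ n) = scal (q i i ^ n) (theta i ^ n)"
  by (induction n) simp_all

lemma rder_theta_power: "rder i (theta i ^ Suc n) = scal (qnum i (Suc n)) (theta i ^ n)"
proof (induction n)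
  case (Suc n)
  have "rder i (theta i ^ Suc (Suc n)) = theta i * rder i (theta i ^ Suc n) + tau i (theta i ^ Suc n)"
    by (subst power_Suc) (simp del: power_Suc)
  also have "\<dots> = scal (qnum i (Suc n)) (theta i ^ Suc n) + scal (q i i ^ Suc n) (theta i ^ Suc n)"
    by (simp only: Suc.IH tau_theta_power scal_mult_right power_Suc[symmetric])
  also have "\<dots> = scal (qnum i (Suc (Suc n))) (theta i ^ Suc n)"
    by (simp add: qnum_def scal_add_left)
  finally show ?case .
qed (simp add: qnum_def)

lemma rder_mult_theta_power:
  assumes "rder i y = 0"
  shows "rder i (y * theta i ^ n) = scal (qnum i n) (y * theta i ^ (n - 1))"
proof (cases n)
  case 0
  then show ?thesis by (simp add: assms qnum_def)
next
  case (Suc m)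
  then show ?thesis using rder_theta_power[of i m] by (simp add: rder_mult assms del: power_Suc)
qed

text \<open>Truncated subtraction does no harm: for k > n the product contains the factor
  \<open>qnum i 0 = 0\<close>.\<close>

lemma rder_funpow_mult_theta_power:
  assumes "rder i y = 0"
  shows "(rder i ^^ k) (y * theta i ^ n) = scal (\<Prod>l<k. qnum i (n - l)) (y * theta i ^ (n - k))"
  by (induction k) (simp_all add: rder_mult_theta_power[OF assms] mult_ac)

lemma rder_funpow_linear:
  "(rder i ^^ k) (x + y) = (rder i ^^ k) x + (rder i ^^ k) y"
  "(rder i ^^ k) (x - y) = (rder i ^^ k) x - (rder i ^^ k) y" "(rder i ^^ k) 0 = 0"
  by (induction k) simp_all

lemma rder_funpow_sum: "(rder i ^^ k) (sum f A) = (\<Sum>a\<in>A. (rder i ^^ k) (f a))"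
  by (induction A rule: infinite_finite_induct) (simp_all add: rder_funpow_linear)

lemma adj_funpow_linear:
  "(adj i ^^ k) (x + y) = (adj i ^^ k) x + (adj i ^^ k) y"
  "(adj i ^^ k) (x - y) = (adj i ^^ k) x - (adj i ^^ k) y"
  "(adj i ^^ k) (scal c x) = scal c ((adj i ^^ k) x)"
  "(adj i ^^ k) 0 = 0"
  by (induction k) simp_all

lemma tau_adj_funpow: "tau i ((adj i ^^ k) x) = scal (q i i ^ k) ((adj i ^^ k) (tau i x))"
  by (induction k) (simp_all add: wdiag_chi_adj mult_ac)

lemma sig_tau_adj_funpow:
  "sig i (tau i ((adj i ^^ k) x)) = scal (q i i ^ (2 * k)) ((adj i ^^ k) (sig i (tau i x)))"
  by (induction k) (simp_all add: wdiag_chi_adj mult_ac)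

end

locale cartan_form = twisted_form \<Omega> for \<Omega> :: "'i::finite \<Rightarrow> 'i \<Rightarrow> int" +
  assumes pos: "\<Omega> i i > 0"
begin

lemma q_self: "q i i = vv powi (- 2 * \<Omega> i i)"
  by (simp add: chi_def dot_def ang_def bilin_simple)

lemma theta_norm_nonzero: "theta_norm i \<noteq> 0"
proof -
  have "v_at \<Omega> i powi (-2) = vv powi (\<Omega> i i * (-2))"
    unfolding power_int_mult by (simp add: v_at_def dot_def ang_def bilin_simple)
  moreover have "vv powi (\<Omega> i i * (-2)) \<noteq> 1"
    using pos[of i] by (simp add: vv_powi_eq_one)
  ultimately show ?thesis by (simp add: theta_norm_def)
qed

text \<open>By adjunction with left multiplication by \<open>theta i\<close>: the test vector undoes
  the invertible twist, and \<open>theta_norm i\<close> is nonzero.\<close>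

lemma rad_lder: "x \<in> rad \<Longrightarrow> lder i x \<in> rad"
proof -
  assume x: "x \<in> rad"
  have "bform y (lder i x) = 0" for y
  proof -
    have "om i (wdiag (\<lambda>\<beta>. inverse (twist (simple i) \<beta>)) y) = y"
      by (simp add: wdiag_wdiag)
    then have "theta_norm i * bform y (lder i x) = bform (theta i * wdiag (\<lambda>\<beta>. inverse (twist (simple i) \<beta>)) y) x"
      by (simp add: bform_theta_mult)
    then show ?thesis using x theta_norm_nonzero[of i] by (simp add: rad_def)
  qed
  then show ?thesis by (simp add: rad_def)
qed

lemma rad_rder: "x \<in> rad \<Longrightarrow> rder i x \<in> rad"
proof -
  assume x: "x \<in> rad"
  have "bform y (rder i x) = 0" for y
  proof -
    have "om' i (wdiag (\<lambda>\<beta>. inverse (twist \<beta> (simple i))) y) = y"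
      by (simp add: wdiag_wdiag)
    then have "theta_norm i * bform y (rder i x) = bform (wdiag (\<lambda>\<beta>. inverse (twist \<beta> (simple i))) y * theta i) x"
      by (simp add: bform_mult_theta)
    then show ?thesis using x theta_norm_nonzero[of i] by (simp add: rad_def)
  qed
  then show ?thesis by (simp add: rad_def)
qed

lemma rad_antipode: "x \<in> rad \<Longrightarrow> antipode x \<in> rad"
proof -
  have "x \<in> len_less n \<Longrightarrow> x \<in> rad \<Longrightarrow> antipode x \<in> rad" for n
  proof (induction n arbitrary: x)
    case 0
    then show ?case by (simp add: len_less_0)
  next
    case (Suc n)
    show ?case
    proof (rule mem_radI)
      show "eps (antipode x) = 0" using Suc.prems by (simp add: eps_antipode rad_eps)
      show "lder i (antipode x) \<in> rad" for i
        using Suc.prems by (auto simp: lder_antipode intro!: rad_uminus Suc.IH len_less_rder rad_rder len_less_closed(5) rad_closed(4))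
    qed
  qed
  then show "x \<in> rad \<Longrightarrow> antipode x \<in> rad" using len_less_exists by blast
qed

end

text \<open>The properties of the Serre ideal from which the inclusion of the radical is derived.
  \<open>J_tau\<close> lets \<open>adj i\<close> act modulo \<open>J\<close>, and
  \<open>J_lder\<close> lets strings be lowered modulo \<open>J\<close>.\<close>

locale serre_ideal = cartan_form \<Omega> for \<Omega> :: "'i::finite \<Rightarrow> 'i \<Rightarrow> int" +
  fixes J :: "'i falg set"
  assumes ideal: "two_sided_ideal J"
    and J_tau: "x \<in> J \<Longrightarrow> tau i x \<in> J"
    and J_lder: "x \<in> J \<Longrightarrow> lder i x \<in> J"
    and J_adj_nilpotent: "i \<noteq> j \<Longrightarrow> \<exists>N. (adj i ^^ N) (theta j) \<in> J"
begin

lemma J_closed [simp]: "0 \<in> J" "x \<in> J \<Longrightarrow> y \<in> J \<Longrightarrow> x + y \<in> J"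
  "x \<in> J \<Longrightarrow> a * x \<in> J" "x \<in> J \<Longrightarrow> x * a \<in> J" "x \<in> J \<Longrightarrow> scal c x \<in> J"
  using ideal by (simp_all add: two_sided_ideal_def scal_eq_mult)

lemma J_diff [simp]: "x \<in> J \<Longrightarrow> y \<in> J \<Longrightarrow> x - y \<in> J"
  using J_closed(2)[of x "- y"] J_closed(5)[of y "-1"] by simp

lemma J_sum: "(\<And>a. a \<in> A \<Longrightarrow> f a \<in> J) \<Longrightarrow> sum f A \<in> J"
  by (induction A rule: infinite_finite_induct) simp_all

lemma J_scal_iff: "c \<noteq> 0 \<Longrightarrow> scal c x \<in> J \<longleftrightarrow> x \<in> J"
  using J_closed(5)[of "scal c x" "inverse c"] by auto

lemma J_adj [simp]: "x \<in> J \<Longrightarrow> adj i x \<in> J"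
  by (simp add: adj_def J_tau)

lemma J_adj_funpow [simp]: "x \<in> J \<Longrightarrow> (adj i ^^ k) x \<in> J"
  by (induction k) simp_all

text \<open>The radical is a coideal because the form is nondegenerate modulo the radical.\<close>

lemma sum_antipode_mult_in_J:
  assumes J: "rad \<inter> len_less n \<subseteq> J" and fin: "finite M"
    and "\<And>p. p \<in> M \<Longrightarrow> a p \<in> len_less n" "\<And>p. p \<in> M \<Longrightarrow> b p \<in> len_less n"
    and "\<And>y z. (\<Sum>p\<in>M. bform y (a p) * bform z (b p)) = 0"
  shows "(\<Sum>p\<in>M. antipode (a p) * b p) \<in> J"
  using fin assms(3-)
proof (induction M arbitrary: b rule: finite_induct)
  case (insert m M)
  show ?case
  proof (cases "b m \<in> rad")
    case True
    then have "bform z (b m) = 0" for z by (simp add: rad_def)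
    then have "(\<Sum>p\<in>M. bform y (a p) * bform z (b p)) = 0" for y z
      using insert.prems(3)[of y z] insert.hyps by simp
    then have "(\<Sum>p\<in>M. antipode (a p) * b p) \<in> J"
      by (intro insert.IH) (simp_all add: insert.prems)
    moreover have "b m \<in> J" using True insert.prems(2) J by auto
    ultimately show ?thesis using insert.hyps by simp
  next
    case False
    then obtain z0 where z0: "bform z0 (b m) \<noteq> 0" by (auto simp: rad_def)
    \<comment> \<open>The functional \<open>z0\<close> separates \<open>b m\<close> from the
      radical. The tensor is regrouped as the sum over \<open>M\<close> of a p \<otimes> (b p - c p
      b m) plus a' \<otimes> b m; pairing the second factor with \<open>z0\<close> kills the first
      part, so \<open>a'\<close> lies in the radical, and one summand is eliminated.\<close>
    define c where "c p = bform z0 (b p) / bform z0 (b m)" for p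
    define a' where "a' = a m + (\<Sum>p\<in>M. scal (c p) (a p))"
    have bform_sum: "bform y (\<Sum>p\<in>M. f p) = (\<Sum>p\<in>M. bform y (f p))" for y f
      using insert.hyps(1) by (induction M rule: finite_induct) simp_all
    have "bform y a' * bform z0 (b m) = 0" for y
    proof -
      have "c p * bform y (a p) * bform z0 (b m) = bform y (a p) * bform z0 (b p)" for p
        using z0 by (simp add: c_def)
      then have "bform y a' * bform z0 (b m) =
          bform y (a m) * bform z0 (b m) + (\<Sum>p\<in>M. bform y (a p) * bform z0 (b p))"
        by (simp only: a'_def bform_sum bform_add_right bform_scal_right distrib_right sum_distrib_right)
      then show ?thesis using insert.prems(3)[of y z0] insert.hyps by simp
    qed
    then have a'_rad: "a' \<in> rad" using z0 by (simp add: rad_def)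
    have "(\<Sum>p\<in>M. scal (c p) (a p)) \<in> len_less n"
      using insert.prems(1) by (intro len_less_sum) simp
    then have "a' \<in> len_less n" by (simp add: a'_def insert.prems)
    then have antipode_a': "antipode a' \<in> J" using a'_rad J by (auto intro: rad_antipode len_less_antipode)
    have "(\<Sum>p\<in>M. antipode (a p) * (b p - scal (c p) (b m))) \<in> J"
    proof (rule insert.IH)
      show "b p - scal (c p) (b m) \<in> len_less n" if "p \<in> M" for p
        using that len_less_closed(2)[of "b p" n "- scal (c p) (b m)"] by (simp add: insert.prems)
      show "(\<Sum>p\<in>M. bform y (a p) * bform z (b p - scal (c p) (b m))) = 0" for y z
      proof -
        have "bform y a' = 0" using a'_rad by (simp add: rad_def)
        then have "(\<Sum>p\<in>M. c p * bform y (a p)) = - bform y (a m)"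
          by (simp add: a'_def bform_sum add_eq_0_iff)
        moreover have "(\<Sum>p\<in>M. bform y (a p) * bform z (b p)) = - (bform y (a m) * bform z (b m))"
          using insert.prems(3)[of y z] insert.hyps by (simp add: add_eq_0_iff)
        moreover have "(\<Sum>p\<in>M. bform y (a p) * bform z (b p - scal (c p) (b m))) =
           (\<Sum>p\<in>M. bform y (a p) * bform z (b p)) - (\<Sum>p\<in>M. c p * bform y (a p)) * bform z (b m)"
          unfolding bform_diff_right bform_scal_right right_diff_distrib sum_subtractf sum_distrib_right
          by (simp only: mult_ac)
        ultimately show ?thesis by simp
      qed
    qed (simp add: insert.prems)
    moreover have "(\<Sum>p\<in>insert m M. antipode (a p) * b p) =
       (\<Sum>p\<in>M. antipode (a p) * (b p - scal (c p) (b m))) + antipode a' * b m"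
    proof -
      have "antipode (\<Sum>p\<in>M. f p) = (\<Sum>p\<in>M. antipode (f p))" for f
        using insert.hyps(1) by (induction M rule: finite_induct) simp_all
      then show ?thesis
        using insert.hyps by (simp add: a'_def algebra_simps sum_subtractf sum_distrib_right)
    qed
    ultimately show ?thesis using antipode_a' by simp
  qed
qed simp

lemma antipode_add_in_J:
  assumes J: "rad \<inter> len_less n \<subseteq> J" and x: "x \<in> rad" "x \<in> len_less (Suc n)"
  shows "x + antipode x \<in> J"
proof -
  let ?X = "coprod \<Omega> x" and ?M = "Poly_Mapping.keys (middle (coprod \<Omega> x))"
  let ?c = "Poly_Mapping.lookup (middle ?X)"
  have decomp: "?X = middle ?X + tens 1 x + tens x 1"
    using middle_decomp[of ?X] rad_eps[OF x(1)] by (simp add: counit_coprod)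
  \<comment> \<open>Both words are nonempty and their total length is at most n, so each is shorter
    than n, in the range where the radical is known to lie in \<open>J\<close>.\<close>
  have len: "length (letters (fst p)) < n \<and> length (letters (snd p)) < n" if "p \<in> ?M" for p
  proof -
    obtain a b where p: "p = (a, b)" by (cases p)
    have "a \<noteq> 0" "b \<noteq> 0" "(a, b) \<in> Poly_Mapping.keys ?X"
      using that by (auto simp: p in_keys_iff lookup_middle split: if_splits)
    moreover have "length (letters a) \<noteq> 0" "length (letters b) \<noteq> 0"
      using calculation by (cases a; cases b; auto simp: zero_fmon_def)+
    moreover have "length (letters a) + length (letters b) < Suc n"
      using total_len_less_coprod[OF x(2)] calculation by (auto simp: total_len_less_def)
    ultimately have "length (letters a) < n" "length (letters b) < n" by linarith+
    then show ?thesis by (simp add: p)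
  qed
  have "(\<Sum>p\<in>?M. antipode (scal (?c p) (mon (fst p))) * mon (snd p)) \<in> J"
  proof (rule sum_antipode_mult_in_J[OF J])
    fix y z
    have "pair (bform y) (bform z) ?X = pair (bform y) (bform z) (middle ?X) + bform y 1 * bform z x + bform y x * bform z 1"
      by (subst decomp) (simp add: pair_tens)
    then have "pair (bform y) (bform z) (middle ?X) = 0"
      using x(1) by (simp add: pair_rad) (simp add: rad_def)
    then show "(\<Sum>p\<in>?M. bform y (scal (?c p) (mon (fst p))) * bform z (mon (snd p))) = 0"
      by (simp add: pair_def linfun_def mult_ac del: scal_simps(6))
  qed (use len in \<open>auto intro!: len_less_single\<close>)
  also have "(\<Sum>p\<in>?M. antipode (scal (?c p) (mon (fst p))) * mon (snd p)) = antipode_mult (middle ?X)"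
    by (simp add: antipode_mult_def linext_def del: scal_simps(6))
  also have "antipode_mult (middle ?X) = - (x + antipode x)"
  proof -
    have "antipode_mult ?X = antipode_mult (middle ?X) + x + antipode x"
      by (subst decomp) (simp add: antipode_mult_tens)
    then show ?thesis using rad_eps[OF x(1)] by (simp add: antipode_mult_coprod scal_add_left algebra_simps add_eq_0_iff)
  qed
  finally show ?thesis using J_closed(5)[of "- (x + antipode x)" "-1"] by simp
qed

text \<open>With S the antipode, x + S x and S x + S (S x) both lie in \<open>J\<close>; their
  difference is a scalar multiple of x.\<close>

lemma antipode_sq_eq_one:
  assumes J: "rad \<inter> len_less n \<subseteq> J" and x: "x \<in> rad" "x \<in> len_less (Suc n)" "homogeneous \<beta> x" "x \<notin> J"
  shows "antipode_sq \<beta> = 1"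
proof -
  have "x + antipode x - (antipode x + antipode (antipode x)) \<in> J"
    using x by (intro J_diff antipode_add_in_J[OF J] rad_antipode len_less_antipode)
  also have "x + antipode x - (antipode x + antipode (antipode x)) = scal (1 - antipode_sq \<beta>) x"
    by (simp add: antipode_antipode homogeneous_wdiag[OF x(3)] scal_diff_left)
  finally have "scal (1 - antipode_sq \<beta>) x \<in> J" .
  then show ?thesis using x(4) J_scal_iff[of "1 - antipode_sq \<beta>" x] by (cases "antipode_sq \<beta> = 1") simp_all
qed

end

section \<open>The radical lies in every suitable ideal\<close>

context cartan_form
begin

lemma q_self_power: "q i i ^ n = vv powi (- 2 * \<Omega> i i * int n)"
  unfolding power_int_mult[of vv "- 2 * \<Omega> i i"] q_self by simp

lemma q_self_power_eq_one: "q i i ^ n = 1 \<longleftrightarrow> n = 0"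
  using pos[of i] by (simp add: q_self_power vv_powi_eq_one)

lemma qnum_nonzero:
  assumes "n > 0"
  shows "qnum i n \<noteq> 0"
proof -
  have "(1 - q i i) * qnum i n = 1 - q i i ^ n"
    unfolding qnum_def by (simp add: one_diff_power_eq)
  then show ?thesis using assms q_self_power_eq_one[of i n] by auto
qed

text \<open>The structure constants by which \<open>lder i\<close> lowers the \<open>adj i\<close>-string through a lowest weight vector.\<close>

primrec ladder :: "'i \<Rightarrow> qvt \<Rightarrow> nat \<Rightarrow> qvt" where
  "ladder i h 0 = 0"
| "ladder i h (Suc n) = 1 - q i i ^ (2 * n) * h + q i i * ladder i h n"

text \<open>Iterates \<open>lder_adj\<close>, the Cartan element multiplying by a further
  \<open>q i i\<close> squared at each step. The truncated \<open>n - 1\<close> at n = 0 is harmless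
  because \<open>ladder i h 0 = 0\<close>.\<close>

lemma lder_adj_funpow:
  assumes "sig i (tau i x) = scal h x"
  shows "lder i ((adj i ^^ n) x) =
    scal (ladder i h n) ((adj i ^^ (n - 1)) x) + scal (q i i ^ n) ((adj i ^^ n) (lder i x))"
proof (induction n)
  case (Suc n)
  have "scal (ladder i h n) (adj i ((adj i ^^ (n - 1)) x)) = scal (ladder i h n) ((adj i ^^ n) x)"
    by (cases n) simp_all
  then show ?case
    using Suc.IH by (simp add: lder_adj sig_tau_adj_funpow assms adj_funpow_linear scal_add_left
        scal_diff_left flip: scal_simps(5))
qed simp

text \<open>With q = \<open>q i i\<close>, this is ladder = (1 - q^n)(1 - q^(n-1) h)/(1 - q), with
  denominators cleared and the negative power at n = 0 avoided by one extra factor q.\<close>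

lemma ladder_eq: "q i i * ((1 - q i i) * ladder i h n) = (1 - q i i ^ n) * (q i i - q i i ^ n * h)"
proof (induction n)
  case (Suc n)
  have "q i i * ((1 - q i i) * ladder i h (Suc n)) =
      q i i * (1 - q i i) * (1 - q i i ^ (2 * n) * h) + q i i * (q i i * ((1 - q i i) * ladder i h n))"
    by (simp add: algebra_simps)
  also have "\<dots> = (1 - q i i ^ Suc n) * (q i i - q i i ^ Suc n * h)"
    unfolding Suc.IH by (simp add: algebra_simps power_mult power2_eq_square power_mult_distrib)
  finally show ?case .
qed simp

text \<open>Vanishing would need q^n h = 1, where q^n h is a power of v whose exponent is strictly
  negative when \<beta> \<cdot> i > 0.\<close>

lemma ladder_nonzero:
  assumes "dot \<Omega> \<beta> (simple i) > 0"
  shows "ladder i (vv powi (- 2 * dot \<Omega> \<beta> (simple i))) (Suc n) \<noteq> 0"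
proof -
  let ?h = "vv powi (- 2 * dot \<Omega> \<beta> (simple i))"
  have "q i i ^ n * ?h = vv powi (- 2 * \<Omega> i i * int n + - 2 * dot \<Omega> \<beta> (simple i))"
    unfolding q_self_power by (subst power_int_add) simp_all
  moreover have "- 2 * \<Omega> i i * int n + - 2 * dot \<Omega> \<beta> (simple i) < 0"
  proof -
    have "int n * \<Omega> i i \<ge> 0" using pos[of i] by simp
    then show ?thesis using assms by (simp add: mult.commute)
  qed
  ultimately have "q i i ^ n * ?h \<noteq> 1" by (simp add: vv_powi_eq_one)
  moreover have "q i i ^ Suc n \<noteq> 1" by (simp only: q_self_power_eq_one)
  ultimately have "(1 - q i i ^ Suc n) * (q i i * (1 - q i i ^ n * ?h)) \<noteq> 0" by simp
  also have "(1 - q i i ^ Suc n) * (q i i * (1 - q i i ^ n * ?h)) =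
     q i i * ((1 - q i i) * ladder i ?h (Suc n))"
    unfolding ladder_eq by (simp add: algebra_simps)
  finally show ?thesis by auto
qed

end

section \<open>Local nilpotence of the braided adjoint action\<close>

context serre_ideal
begin

text \<open>A subalgebra containing \<open>theta j\<close> for j \<noteq> i and stable under
  \<open>tau i\<close> and \<open>adj i\<close>; it is the space of coefficients for expansions in
  powers of \<open>theta i\<close>.\<close>

definition adj_nil :: "'i \<Rightarrow> 'i falg set" where
  "adj_nil i = {y. rder i y = 0 \<and> (\<exists>N. (adj i ^^ N) y \<in> J)}"

lemma adj_funpow_mono: "(adj i ^^ N) y \<in> J \<Longrightarrow> N \<le> M \<Longrightarrow> (adj i ^^ M) y \<in> J"
  using J_adj_funpow[of "(adj i ^^ N) y" "M - N" i] funpow_add[of "M - N" N "adj i"] by simp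

lemma adj_nil_add: "x \<in> adj_nil i \<Longrightarrow> y \<in> adj_nil i \<Longrightarrow> x + y \<in> adj_nil i"
proof -
  assume "x \<in> adj_nil i" "y \<in> adj_nil i"
  then obtain N M where "(adj i ^^ N) x \<in> J" "(adj i ^^ M) y \<in> J" "rder i x = 0" "rder i y = 0"
    by (auto simp: adj_nil_def)
  then have "rder i (x + y) = 0" "(adj i ^^ (max N M)) (x + y) \<in> J"
    by (auto simp: adj_funpow_linear intro!: J_closed(2) intro: adj_funpow_mono)
  then show ?thesis by (auto simp: adj_nil_def)
qed

lemma adj_nil_scal: "x \<in> adj_nil i \<Longrightarrow> scal c x \<in> adj_nil i"
  by (auto simp: adj_nil_def adj_funpow_linear intro: J_closed(5))

lemma adj_nil_zero: "0 \<in> adj_nil i"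
  by (auto simp: adj_nil_def adj_funpow_linear)

lemma adj_nil_one: "1 \<in> adj_nil i"
  by (auto simp: adj_nil_def intro!: exI[of _ 1])

lemma adj_nil_theta: "i \<noteq> j \<Longrightarrow> theta j \<in> adj_nil i"
  using J_adj_nilpotent by (auto simp: adj_nil_def)

lemma adj_funpow_tau: "(adj i ^^ N) x \<in> J \<Longrightarrow> (adj i ^^ N) (tau i x) \<in> J"
  using J_tau[of "(adj i ^^ N) x" i] by (simp add: tau_adj_funpow J_scal_iff)

lemma adj_nil_tau: "x \<in> adj_nil i \<Longrightarrow> tau i x \<in> adj_nil i"
  by (auto simp: adj_nil_def intro: adj_funpow_tau)

lemma adj_nil_adj: "x \<in> adj_nil i \<Longrightarrow> adj i x \<in> adj_nil i"
proof -
  assume "x \<in> adj_nil i"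
  then obtain N where "(adj i ^^ N) x \<in> J" "rder i x = 0" by (auto simp: adj_nil_def)
  then have "(adj i ^^ N) (adj i x) \<in> J" "rder i (adj i x) = 0"
    by (simp_all add: rder_adj flip: funpow_swap1)
  then show ?thesis by (auto simp: adj_nil_def)
qed

text \<open>Skew Leibniz rule: each application of \<open>adj i\<close> lowers the exponent still
  owed by one of the two factors, and a factor owing nothing already lies in
  \<open>J\<close>.\<close>

lemma adj_funpow_mult: "(adj i ^^ N) x \<in> J \<Longrightarrow> (adj i ^^ M) y \<in> J \<Longrightarrow> (adj i ^^ (N + M)) (x * y) \<in> J"
proof (induction "N + M" arbitrary: N M x y)
  case 0
  then show ?case by simp
next
  case (Suc s)
  show ?case
  proof (cases N; cases M)
    fix N' M' assume NM: "N = Suc N'" "M = Suc M'"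
    have "(adj i ^^ (N' + M)) (adj i x * y) \<in> J"
      using Suc NM by (intro Suc.hyps(1)) (simp_all add: funpow_Suc_right del: funpow.simps)
    moreover have "(adj i ^^ (N + M')) (tau i x * adj i y) \<in> J"
      using Suc NM
      by (intro Suc.hyps(1) adj_funpow_tau) (simp_all add: funpow_Suc_right del: funpow.simps)
    ultimately show ?thesis
      using NM by (simp add: adj_mult adj_funpow_linear funpow_Suc_right del: funpow.simps(2))
  qed (use Suc.prems in \<open>simp_all del: funpow.simps(2)\<close>)
qed

lemma adj_nil_mult: "x \<in> adj_nil i \<Longrightarrow> y \<in> adj_nil i \<Longrightarrow> x * y \<in> adj_nil i"
  by (auto simp: adj_nil_def rder_mult intro: adj_funpow_mult)

text \<open>Normal ordering moves every \<open>theta i\<close> to the right. Requiring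
  \<open>y k = 0\<close> from \<open>m\<close> on lets expansions of different lengths be
  added.\<close>

lemma adj_nil_expansion:
  "\<exists>m y. (\<forall>k. y k \<in> adj_nil i) \<and> (\<forall>k\<ge>m. y k = 0) \<and> x = (\<Sum>k<m. y k * theta i ^ k)"
proof (induction x rule: falg_induct)
  case one
  show ?case
    by (rule exI[of _ 1], rule exI[of _ "\<lambda>k. if k = 0 then 1 else 0"]) (simp add: adj_nil_one adj_nil_zero)
next
  case (theta j x)
  then obtain m y where y: "\<And>k. y k \<in> adj_nil i" "\<And>k. k \<ge> m \<Longrightarrow> y k = 0"
    "x = (\<Sum>k<m. y k * theta i ^ k)" by blast
  show ?case
  proof (cases "i = j")
    case False
    then show ?thesis
      using y
      by (intro exI[of _ m] exI[of _ "\<lambda>k. theta j * y k"])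
         (simp add: adj_nil_mult adj_nil_theta sum_distrib_left mult.assoc)
  next
    case True
    \<comment> \<open>From theta i * y = adj i y + tau i y * theta i: the second term passes to the
      next power, which explains the shift of the index.\<close>
    define y' where "y' k = adj i (y k) + (case k of 0 \<Rightarrow> 0 | Suc l \<Rightarrow> tau i (y l))" for k
    have "y' k \<in> adj_nil i" for k
      using y(1) by (auto simp: y'_def split: nat.split intro: adj_nil_add adj_nil_adj adj_nil_tau adj_nil_zero)
    moreover have "y' k = 0" if "k \<ge> Suc m" for k
      using y(2) that by (cases k) (simp_all add: y'_def)
    moreover have "theta j * x = (\<Sum>k<Suc m. y' k * theta i ^ k)"
    proof -
      have "(\<Sum>k<Suc m. y' k * theta i ^ k) = (\<Sum>k<Suc m. adj i (y k) * theta i ^ k) +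
         (\<Sum>k<Suc m. (case k of 0 \<Rightarrow> 0 | Suc l \<Rightarrow> tau i (y l)) * theta i ^ k)"
        by (simp only: y'_def distrib_right sum.distrib)
      also have "(\<Sum>k<Suc m. adj i (y k) * theta i ^ k) = (\<Sum>k<m. adj i (y k) * theta i ^ k)"
        by (simp add: y(2))
      also have "(\<Sum>k<Suc m. (case k of 0 \<Rightarrow> 0 | Suc l \<Rightarrow> tau i (y l)) * theta i ^ k) =
         (\<Sum>k<m. tau i (y k) * theta i ^ Suc k)"
        by (subst sum.lessThan_Suc_shift) simp
      also have "(\<Sum>k<m. adj i (y k) * theta i ^ k) + (\<Sum>k<m. tau i (y k) * theta i ^ Suc k) = theta i * x"
        unfolding y(3) sum_distrib_left sum.distrib[symmetric]
        by (intro sum.cong) (simp_all add: adj_def algebra_simps)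
      finally show ?thesis by (simp add: True)
    qed
    ultimately show ?thesis by blast
  qed
next
  case (scal c x)
  then obtain m y where y: "\<And>k. y k \<in> adj_nil i" "\<And>k. k \<ge> m \<Longrightarrow> y k = 0"
    "x = (\<Sum>k<m. y k * theta i ^ k)" by blast
  then show ?case
    by (intro exI[of _ m] exI[of _ "\<lambda>k. scal c (y k)"]) (simp add: adj_nil_scal scal_sum)
next
  case (add x x')
  then obtain m y m' y' where y: "\<And>k. y k \<in> adj_nil i" "\<And>k. k \<ge> m \<Longrightarrow> y k = 0"
    "x = (\<Sum>k<m. y k * theta i ^ k)" and y': "\<And>k. y' k \<in> adj_nil i" "\<And>k. k \<ge> m' \<Longrightarrow> y' k = 0"
    "x' = (\<Sum>k<m'. y' k * theta i ^ k)" by blast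
  have "x = (\<Sum>k<max m m'. y k * theta i ^ k)"
    unfolding y(3) by (rule sum.mono_neutral_left) (auto simp: y(2))
  moreover have "x' = (\<Sum>k<max m m'. y' k * theta i ^ k)"
    unfolding y'(3) by (rule sum.mono_neutral_left) (auto simp: y'(2))
  ultimately have "x + x' = (\<Sum>k<max m m'. (y k + y' k) * theta i ^ k)"
    by (simp add: distrib_right sum.distrib)
  then show ?case
    using y(1,2) y'(1,2)
    by (intro exI[of _ "max m m'"] exI[of _ "\<lambda>k. y k + y' k"]) (simp add: adj_nil_add)
qed

text \<open>The m-th right derivative isolates the coefficient of the m-th power, up to a nonzero
  quantum factorial; removing that term allows descent. The zeroth coefficient is out of reach
  because no assumption is made on x itself.\<close>

lemma expansion_coefficients_in_J:
  assumes "\<And>k. rder i (y k) = 0"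
    and "\<And>k. k > 0 \<Longrightarrow> (rder i ^^ k) (\<Sum>l<m. y l * theta i ^ l) \<in> J"
  shows "0 < k \<Longrightarrow> k < m \<Longrightarrow> y k \<in> J"
  using assms(2)
proof (induction m)
  case (Suc m)
  have "y m \<in> J" if "m > 0"
  proof -
    have "(rder i ^^ m) (\<Sum>l<Suc m. y l * theta i ^ l) =
       (\<Sum>l<Suc m. (rder i ^^ m) (y l * theta i ^ l))"
      by (rule rder_funpow_sum)
    also have "\<dots> = (rder i ^^ m) (y m * theta i ^ m)"
    proof -
      \<comment> \<open>Lower powers die: the factor with l' = l is \<open>qnum i 0\<close>.\<close>
      have "(rder i ^^ m) (y l * theta i ^ l) = 0" if "l < m" for l
      proof -
        have "(\<Prod>l'<m. qnum i (l - l')) = 0"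
          using that by (auto intro!: prod_zero bexI[of _ l] simp: qnum_def)
        then show ?thesis
          unfolding rder_funpow_mult_theta_power[OF assms(1)] by (simp only: scal_simps(1))
      qed
      then show ?thesis by simp
    qed
    also have "\<dots> = scal (\<Prod>l<m. qnum i (m - l)) (y m)"
      by (simp add: rder_funpow_mult_theta_power[OF assms(1)])
    finally have "scal (\<Prod>l<m. qnum i (m - l)) (y m) \<in> J" using Suc.prems(3)[OF that] by simp
    moreover have "(\<Prod>l<m. qnum i (m - l)) \<noteq> 0" by (simp add: qnum_nonzero)
    ultimately show ?thesis by (simp add: J_scal_iff)
  qed
  note ym = this
  show ?case
  proof (cases "k = m")
    case True
    then show ?thesis using ym Suc.prems by simp
  next
    case False
    have "(rder i ^^ j) (\<Sum>l<m. y l * theta i ^ l) \<in> J" if "j > 0" for j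
    proof -
      have "m > 0" using Suc.prems False by simp
      then have "(rder i ^^ j) (y m * theta i ^ m) \<in> J"
        by (simp add: rder_funpow_mult_theta_power[OF assms(1)] ym)
      then have "(rder i ^^ j) (\<Sum>l<Suc m. y l * theta i ^ l) - (rder i ^^ j) (y m * theta i ^ m) \<in> J"
        using Suc.prems(3)[OF that] by simp
      then show ?thesis by (simp add: rder_funpow_linear)
    qed
    then show ?thesis using Suc False by simp
  qed
qed simp

lemma adj_nilpotent:
  assumes "\<And>k. k > 0 \<Longrightarrow> (rder i ^^ k) x \<in> J"
  shows "\<exists>N. (adj i ^^ N) x \<in> J"
proof -
  obtain m y where y: "\<And>k. y k \<in> adj_nil i" "\<And>k. k \<ge> m \<Longrightarrow> y k = 0"
    "x = (\<Sum>k<m. y k * theta i ^ k)" using adj_nil_expansion[of i x] by blast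
  have yJ: "y k \<in> J" if "k > 0" for k
  proof (cases "k < m")
    case True
    then show ?thesis
      using expansion_coefficients_in_J[of i y m k] y(1) assms that
      unfolding y(3) by (simp add: adj_nil_def)
  qed (simp add: y(2))
  have x: "x - y 0 \<in> J"
  proof (cases m)
    case 0
    then show ?thesis using y(2)[of 0] y(3) by simp
  next
    case (Suc m')
    then have "x - y 0 = (\<Sum>k<m'. y (Suc k) * theta i ^ Suc k)"
      unfolding y(3) Suc by (subst sum.lessThan_Suc_shift) simp
    then show ?thesis using yJ by (auto intro: J_sum)
  qed
  obtain N where "(adj i ^^ N) (y 0) \<in> J" using y(1)[of 0] by (auto simp: adj_nil_def)
  then have "(adj i ^^ N) (x - y 0) + (adj i ^^ N) (y 0) \<in> J" using x by (intro J_closed(2)) simp_all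
  then show ?thesis by (auto simp: adj_funpow_linear)
qed

lemma dot_nonpos:
  assumes x: "homogeneous \<beta> x" "x \<notin> J" "lder i x \<in> J" "\<And>k. k > 0 \<Longrightarrow> (rder i ^^ k) x \<in> J"
  shows "dot \<Omega> \<beta> (simple i) \<le> 0"
proof (rule ccontr)
  assume neg: "\<not> ?thesis"
  let ?h = "vv powi (- 2 * dot \<Omega> \<beta> (simple i))"
  have h: "sig i (tau i x) = scal ?h x"
    by (simp add: homogeneous_wdiag[OF x(1)] chi_swap dot_def add.commute)
  obtain N where "(adj i ^^ N) x \<in> J" using adj_nilpotent[OF x(4)] by blast
  then have "x \<in> J"
  \<comment> \<open>Descent along the string: \<open>lder i\<close> brings the next power of
    \<open>adj i\<close> down to a nonzero multiple of the current one modulo \<open>J\<close>,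
    until x itself falls into \<open>J\<close>.\<close>
  proof (induction N)
    case (Suc N)
    have "lder i ((adj i ^^ Suc N) x) \<in> J" using Suc.prems by (rule J_lder)
    moreover have "scal (q i i ^ Suc N) ((adj i ^^ Suc N) (lder i x)) \<in> J"
      by (intro J_closed(5) J_adj_funpow x(3))
    ultimately have "lder i ((adj i ^^ Suc N) x) - scal (q i i ^ Suc N) ((adj i ^^ Suc N) (lder i x)) \<in> J"
      by (rule J_diff)
    then have "scal (ladder i ?h (Suc N)) ((adj i ^^ N) x) \<in> J"
      unfolding lder_adj_funpow[OF h] by (simp only: add_diff_cancel diff_Suc_1)
    moreover have "ladder i ?h (Suc N) \<noteq> 0"
      using neg by (intro ladder_nonzero) simp
    ultimately have "(adj i ^^ N) x \<in> J" using J_scal_iff by blast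
    then show ?case by (rule Suc.IH)
  qed simp
  with x(2) show False ..
qed

section \<open>Excluding the weight of a minimal counterexample\<close>

lemma bilin_expand: "bilin M \<beta> \<beta> = (\<Sum>i\<in>UNIV. \<beta> i * bilin M \<beta> (simple i))" for M :: "'i \<Rightarrow> 'i \<Rightarrow> int"
proof -
  have "bilin M \<beta> (simple i) = (\<Sum>k\<in>UNIV. \<beta> k * M k i)" for i
  proof -
    have "(\<Sum>l\<in>UNIV. \<beta> k * simple i l * M k l) = \<beta> k * M k i" for k
      using sum_simple[of i "\<lambda>l. \<beta> k * M k l"] by (simp add: mult_ac)
    then show ?thesis by (simp add: bilin_def)
  qed
  then show ?thesis
    by (subst bilin_def, subst sum.swap) (simp add: sum_distrib_left mult_ac)
qed

lemma dot_eq_bilin: "dot \<Omega> x y = bilin (\<lambda>i j. \<Omega> i j + \<Omega> j i) x y"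
proof -
  have "bilin \<Omega> y x = bilin (\<lambda>i j. \<Omega> j i) x y"
    unfolding bilin_def by (subst sum.swap) (simp add: mult_ac)
  then show ?thesis by (simp add: dot_def ang_def) (simp add: bilin_def sum.distrib distrib_left)
qed

lemma rad_subset: "rad \<subseteq> J"
proof -
  have "rad \<inter> len_less n \<subseteq> J" for n
  proof (induction n)
    case 0
    then show ?case by (auto simp: len_less_0)
  next
    case (Suc n)
    have homogeneous_case: "x \<in> J" if x: "x \<in> rad" "x \<in> len_less (Suc n)" "homogeneous \<beta> x" for x \<beta>
    proof (rule ccontr)
      assume "x \<notin> J"
      have "lder i x \<in> J" for i
        using x Suc.IH by (auto intro: rad_lder len_less_lder)
      moreover have "(rder i ^^ k) x \<in> J" if "k > 0" for i k
      proof -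
        \<comment> \<open>The first derivation brings the length bound down to \<open>n\<close>; the
          later ones keep it.\<close>
        have "(rder i ^^ Suc k) x \<in> rad \<inter> len_less n" for k
          by (induction k) (use x in \<open>auto intro: rad_rder len_less_rder len_less_Suc\<close>)
        then show ?thesis using Suc.IH that by (cases k) auto
      qed
      ultimately have dot: "dot \<Omega> \<beta> (simple i) \<le> 0" for i
        using dot_nonpos[OF x(3) \<open>x \<notin> J\<close>] by blast
      have "x \<noteq> 0" using \<open>x \<notin> J\<close> by auto
      then obtain w where w: "w \<in> Poly_Mapping.keys x" by fastforce
      then have \<beta>: "\<beta> = weight w" using homogeneous_keys[OF x(3)] by simp
      have nonneg: "\<beta> i \<ge> 0" for i by (simp add: \<beta> weight_def)
      \<comment> \<open>An element of the radical has counit 0, so the empty word does not occur and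
        \<beta> is not the zero weight.\<close>
      have "w \<noteq> 0" using w rad_eps[OF x(1)] by (auto simp: eps_def in_keys_iff)
      then obtain i l where "letters w = i # l"
        by (cases w; cases "letters w") (auto simp: zero_fmon_def)
      then have i: "\<beta> i > 0" by (simp add: \<beta> weight_def)
      have "dot \<Omega> \<beta> \<beta> = (\<Sum>i\<in>UNIV. \<beta> i * dot \<Omega> \<beta> (simple i))"
        unfolding dot_eq_bilin by (rule bilin_expand)
      then have "dot \<Omega> \<beta> \<beta> \<le> 0"
        using nonneg dot by (simp add: sum_nonpos mult_nonneg_nonpos)
      moreover have "(\<Sum>i\<in>UNIV. \<beta> i * (2 * \<Omega> i i)) > 0"
        using nonneg i pos by (intro sum_pos2[of _ i]) (simp_all add: less_imp_le)
      moreover have "(\<Sum>i\<in>UNIV. \<beta> i * (2 * \<Omega> i i)) - dot \<Omega> \<beta> \<beta> = 0"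
        using antipode_sq_eq_one[OF Suc.IH x \<open>x \<notin> J\<close>] by (simp add: antipode_sq_def vv_powi_eq_one)
      ultimately show False by simp
    qed
    show ?case
    proof
      fix x assume x: "x \<in> rad \<inter> len_less (Suc n)"
      have "(\<Sum>\<beta>\<in>weight ` Poly_Mapping.keys x. wdiag (\<lambda>\<gamma>. of_bool (\<gamma> = \<beta>)) x) \<in> J"
        using x by (intro J_sum homogeneous_case[OF _ _ homogeneous_proj]) simp_all
      then show "x \<in> J" by (simp only: sum_homogeneous_components)
    qed
  qed
  then show ?thesis using len_less_exists by blast
qed

end

section \<open>Quantum Serre elements as iterated braided commutators\<close>

lemma two_sided_ideal_hull: "two_sided_ideal (two_sided_ideal hull S)"
  by (rule hull_in) (auto simp: two_sided_ideal_def)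

lemma zero_choose_two [simp]: "0 choose 2 = 0"
  by (simp add: numeral_2_eq_2)

context twisted_form
begin

text \<open>Coefficient of the monomial with p letters \<open>theta i\<close> to the right of
  \<open>theta j\<close> in the n-th braided commutator. The factor in the recursion is
  \<open>tau i\<close> on a monomial with n letters i and one j.\<close>

primrec adj_coeff :: "'i \<Rightarrow> 'i \<Rightarrow> nat \<Rightarrow> nat \<Rightarrow> qvt" where
  "adj_coeff i j 0 p = of_bool (p = 0)"
| "adj_coeff i j (Suc n) p =
     adj_coeff i j n p - q i i ^ n * q i j * (case p of 0 \<Rightarrow> 0 | Suc p' \<Rightarrow> adj_coeff i j n p')"

lemma adj_coeff_eq_0: "n < p \<Longrightarrow> adj_coeff i j n p = 0"
  by (induction n arbitrary: p) (auto split: nat.split)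

lemma tau_theta_monomial:
  "tau i (theta i ^ m * theta j * theta i ^ p) =
     scal (q i i ^ (m + p) * q i j) (theta i ^ m * theta j * theta i ^ p)"
  by (simp add: wdiag_chi_mult tau_theta_power power_add mult_ac)

lemma adj_funpow_theta:
  "(adj i ^^ n) (theta j) =
     (\<Sum>p\<le>n. scal (adj_coeff i j n p) (theta i ^ (n - p) * theta j * theta i ^ p))"
proof (induction n)
  case (Suc n)
  let ?m = "\<lambda>n p. theta i ^ (n - p) * theta j * theta i ^ p"
  have adj_sum: "adj i (sum f A) = (\<Sum>a\<in>A. adj i (f a))" for f :: "nat \<Rightarrow> _" and A
    by (induction A rule: infinite_finite_induct) simp_all
  have "(adj i ^^ Suc n) (theta j) = (\<Sum>p\<le>n. scal (adj_coeff i j n p) (adj i (?m n p)))"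
    using Suc.IH by (simp add: adj_sum)
  also have "\<dots> = (\<Sum>p\<le>n. scal (adj_coeff i j n p) (?m (Suc n) p) -
      scal (q i i ^ n * q i j * adj_coeff i j n p) (?m (Suc n) (Suc p)))"
  proof (rule sum.cong)
    fix p assume "p \<in> {..n}"
    then have "adj i (?m n p) = ?m (Suc n) p - scal (q i i ^ n * q i j) (?m (Suc n) (Suc p))"
      unfolding adj_def tau_theta_monomial
      by (simp add: Suc_diff_le mult.assoc power_commutes)
    then show "scal (adj_coeff i j n p) (adj i (?m n p)) = scal (adj_coeff i j n p) (?m (Suc n) p) -
      scal (q i i ^ n * q i j * adj_coeff i j n p) (?m (Suc n) (Suc p))"
      by (simp add: mult_ac)
  qed simp
  also have "\<dots> = (\<Sum>p\<le>n. scal (adj_coeff i j n p) (?m (Suc n) p)) -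
      (\<Sum>p\<le>n. scal (q i i ^ n * q i j * adj_coeff i j n p) (?m (Suc n) (Suc p)))"
    by (rule sum_subtractf)
  also have "(\<Sum>p\<le>n. scal (adj_coeff i j n p) (?m (Suc n) p)) =
      (\<Sum>p\<le>Suc n. scal (adj_coeff i j n p) (?m (Suc n) p))"
    by (simp add: adj_coeff_eq_0)
  also have "(\<Sum>p\<le>n. scal (q i i ^ n * q i j * adj_coeff i j n p) (?m (Suc n) (Suc p))) =
      (\<Sum>p\<le>Suc n. scal (q i i ^ n * q i j * (case p of 0 \<Rightarrow> 0 | Suc p' \<Rightarrow> adj_coeff i j n p')) (?m (Suc n) p))"
    by (subst sum.atMost_Suc_shift) simp
  also have "(\<Sum>p\<le>Suc n. scal (adj_coeff i j n p) (?m (Suc n) p)) - \<dots> =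
      (\<Sum>p\<le>Suc n. scal (adj_coeff i j (Suc n) p) (?m (Suc n) p))"
    by (simp only: sum_subtractf[symmetric] scal_diff_left[symmetric] adj_coeff.simps)
  finally show ?case .
qed simp

definition qfac :: "'i \<Rightarrow> nat \<Rightarrow> qvt" where "qfac i n = (\<Prod>k=1..n. qnum i k)"

lemma qfac_Suc [simp]: "qfac i (Suc n) = qfac i n * qnum i (Suc n)" and qfac_0 [simp]: "qfac i 0 = 1"
  by (simp_all add: qfac_def)

lemma qnum_add: "qnum i (m + n) = qnum i m + q i i ^ m * qnum i n"
  by (induction n) (simp_all add: qnum_def power_add algebra_simps)

text \<open>A q-binomial theorem, with the factorials kept on the left to avoid quotients; the
  induction is the q-Pascal rule, here in the form of \<open>qnum_add\<close>.\<close>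

lemma adj_coeff_eq:
  "p \<le> n \<Longrightarrow> adj_coeff i j n p * (qfac i p * qfac i (n - p)) =
     (-1) ^ p * qfac i n * q i i ^ (p choose 2) * q i j ^ p"
proof (induction n arbitrary: p)
  case (Suc n)
  show ?case
  proof (cases p)
    case 0
    have "adj_coeff i j n 0 * qfac i n = qfac i n" using Suc.IH[of 0] by simp
    then show ?thesis using 0 by auto
  next
    case (Suc r)
    have r: "r \<le> n" using Suc.prems Suc by simp
    \<comment> \<open>The common factor of the two terms in the Pascal recursion.\<close>
    define u where "u = (-1) ^ r * qfac i n * q i i ^ (r choose 2) * q i j ^ Suc r"
    have 1: "adj_coeff i j n (Suc r) * (qfac i (Suc r) * qfac i (n - r)) =
        - (u * q i i ^ r * qnum i (n - r))"
    \<comment> \<open>At r = n the recursion reads a coefficient beyond the top one, and the right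
      side vanishes through \<open>qnum i 0\<close>.\<close>
    proof (cases "r = n")
      case True
      then show ?thesis by (simp add: adj_coeff_eq_0 qnum_def)
    next
      case False
      then have "Suc r \<le> n" using r by simp
      from Suc.IH[OF this] have *: "adj_coeff i j n (Suc r) * (qfac i (Suc r) * qfac i (n - Suc r)) =
          - (u * q i i ^ r)"
        by (simp add: u_def power_add numeral_2_eq_2 mult_ac)
      have "n - r = Suc (n - Suc r)" using \<open>Suc r \<le> n\<close> by simp
      then have "qfac i (n - r) = qfac i (n - Suc r) * qnum i (n - r)"
        by (metis qfac_Suc)
      then have "adj_coeff i j n (Suc r) * (qfac i (Suc r) * qfac i (n - r)) =
          adj_coeff i j n (Suc r) * (qfac i (Suc r) * qfac i (n - Suc r)) * qnum i (n - r)"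
        by (simp only: mult.assoc)
      then show ?thesis unfolding * by simp
    qed
    have 2: "adj_coeff i j n r * (qfac i (Suc r) * qfac i (n - r)) * q i j = u * qnum i (Suc r)"
    proof -
      have "adj_coeff i j n r * (qfac i (Suc r) * qfac i (n - r)) * q i j =
          (adj_coeff i j n r * (qfac i r * qfac i (n - r))) * q i j * qnum i (Suc r)"
        by (simp add: mult_ac)
      then show ?thesis unfolding Suc.IH[OF r] by (simp add: u_def mult_ac)
    qed
    have "adj_coeff i j (Suc n) p * (qfac i p * qfac i (Suc n - p)) =
       adj_coeff i j n (Suc r) * (qfac i (Suc r) * qfac i (n - r)) -
       q i i ^ n * (adj_coeff i j n r * (qfac i (Suc r) * qfac i (n - r)) * q i j)"
      unfolding Suc by (simp add: algebra_simps)
    also have "\<dots> = - u * (q i i ^ r * qnum i (n - r) + q i i ^ n * qnum i (Suc r))"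
      unfolding 1 2 by (simp add: algebra_simps)
    also have "q i i ^ r * qnum i (n - r) + q i i ^ n * qnum i (Suc r) = q i i ^ r * qnum i (Suc n)"
    proof -
      have "qnum i (Suc n) = qnum i (n - r + Suc r)" using r by simp
      also have "\<dots> = qnum i (n - r) + q i i ^ (n - r) * qnum i (Suc r)" by (rule qnum_add)
      finally show ?thesis using r by (simp add: distrib_left mult.assoc flip: power_add)
    qed
    also have "- u * (q i i ^ r * qnum i (Suc n)) =
       (-1) ^ p * qfac i (Suc n) * q i i ^ (p choose 2) * q i j ^ p"
      unfolding Suc by (simp add: u_def power_add numeral_2_eq_2 mult_ac)
    finally show ?thesis .
  qed
qed simp

end

section \<open>Comparison with the divided powers\<close>

context cartan_form
begin

lemma qfac_nonzero: "qfac i n \<noteq> 0"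
  by (simp add: qfac_def qnum_nonzero)

lemma v_at_eq: "v_at \<Omega> i = vv powi \<Omega> i i" and t_at_eq: "t_at \<Omega> i = tt powi \<Omega> i i"
  by (simp_all add: v_at_def t_at_def dot_def ang_def bilin_simple)

text \<open>Since \<open>q i i\<close> is the inverse square of v_i, the second base of the
  two-parameter integer is \<open>q i i\<close> times the first; pulling out the first base leaves a
  geometric sum.\<close>

lemma qint_eq: "qint (v_at \<Omega> i) (t_at \<Omega> i) (Suc n) = (v_at \<Omega> i * t_at \<Omega> i) ^ n * qnum i (Suc n)"
proof -
  let ?a = "v_at \<Omega> i * t_at \<Omega> i" and ?q = "q i i"
  have nz: "v_at \<Omega> i \<noteq> 0" "t_at \<Omega> i \<noteq> 0" by (simp_all add: v_at_eq t_at_eq)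
  have q: "?q * (v_at \<Omega> i * v_at \<Omega> i) = 1"
    unfolding q_self v_at_eq by (simp flip: power_int_add)
  then have b: "inverse (v_at \<Omega> i * inverse (t_at \<Omega> i)) = ?q * ?a"
    using nz by (simp add: field_simps)
  have q1: "1 - ?q \<noteq> 0" using q_self_power_eq_one[of i 1] by simp
  have "qint (v_at \<Omega> i) (t_at \<Omega> i) (Suc n) =
     (?a ^ Suc n - inverse (v_at \<Omega> i * inverse (t_at \<Omega> i)) ^ Suc n) /
     (?a - inverse (v_at \<Omega> i * inverse (t_at \<Omega> i)))"
    unfolding qint_def by (simp only: power_int_minus power_int_of_nat power_inverse)
  also have "\<dots> = (?a ^ Suc n * (1 - ?q ^ Suc n)) / (?a * (1 - ?q))"
    unfolding b by (simp add: algebra_simps power_mult_distrib)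
  also have "\<dots> = ?a ^ n * ((1 - ?q ^ Suc n) / (1 - ?q))"
  proof -
    have "(a ^ Suc n * x) / (a * y) = a ^ n * (x / y)" if "a \<noteq> 0" for a x y :: qvt
      using that by simp
    then show ?thesis using nz by simp
  qed
  also have "(1 - ?q ^ Suc n) / (1 - ?q) = qnum i (Suc n)"
    using q1 one_diff_power_eq[of ?q "Suc n"] by (simp add: qnum_def field_simps del: power_Suc)
  finally show ?thesis .
qed

lemma qfact_eq: "qfact (v_at \<Omega> i) (t_at \<Omega> i) n = (v_at \<Omega> i * t_at \<Omega> i) ^ (n choose 2) * qfac i n"
  by (induction n)
     (simp_all add: qfact_def qint_eq power_add numeral_2_eq_2 mult_ac del: One_nat_def)

end

lemma Suc_choose_two: "Suc n choose 2 = n + (n choose 2)"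
  by (simp add: numeral_2_eq_2)

lemma choose_two_add: "(m + n) choose 2 = (m choose 2) + (n choose 2) + m * n"
  by (induction m) (simp_all add: Suc_choose_two)

lemma twice_choose_two: "2 * int (n choose 2) = int n * (int n - 1)"
  by (induction n) (simp_all add: Suc_choose_two algebra_simps)

context cartan_form
begin

text \<open>Here p counts the letters on the right, so the p of the Serre element is n - p. The
  point is that all factors in front of \<open>adj_coeff\<close> are independent of p.\<close>

lemma serre_coeff:
  assumes A: "\<Omega> i j + \<Omega> j i = A * \<Omega> i i" and n: "int n = 1 - A" and p: "p \<le> n"
  shows "(-1) ^ (n - p) * tt powi (- int (n - p) * (int p * \<Omega> i i - \<Omega> i j + \<Omega> j i)) *
      (inverse (qfact (v_at \<Omega> i) (t_at \<Omega> i) (n - p)) * inverse (qfact (v_at \<Omega> i) (t_at \<Omega> i) p)) =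
    (-1) ^ n * vv powi (- \<Omega> i i * int (n choose 2)) *
      tt powi (- \<Omega> i i * int (n choose 2) + int n * (\<Omega> i j - \<Omega> j i)) / qfac i n * adj_coeff i j n p"
proof -
  define r where "r = n - p"
  have npr: "n = p + r" using p by (simp add: r_def)
  let ?d = "\<Omega> i i" and ?c1 = "int (p choose 2)" and ?c2 = "int (r choose 2)" and ?c = "int (n choose 2)"
  have c: "?c = ?c1 + ?c2 + int p * int r"
    unfolding npr choose_two_add by simp
  have c1: "2 * ?c1 = int p * (int p - 1)"
    by (rule twice_choose_two)
  have inv: "inverse ((v_at \<Omega> i * t_at \<Omega> i) ^ k) = vv powi (- ?d * int k) * tt powi (- ?d * int k)" for k
    by (simp add: v_at_eq t_at_eq power_int_mult power_int_minus power_mult_distrib)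
  have qii: "q i i ^ k = vv powi (- 2 * ?d * int k)" for k
    by (rule q_self_power)
  have qij: "q i j ^ p = vv powi (- (A * ?d) * int p) * tt powi ((\<Omega> j i - \<Omega> i j) * int p)"
  proof -
    have "q i j = vv powi (- (A * ?d)) * tt powi (\<Omega> j i - \<Omega> i j)"
      using A by (simp add: chi_def dot_def ang_def bilin_simple algebra_simps)
    then show ?thesis by (simp only: power_int_mult power_mult_distrib power_int_of_nat)
  qed
  \<comment> \<open>The v-exponents match for every p precisely through A = 1 - n, the length of the
    Serre relation.\<close>
  have v: "- ?d * ?c2 + - ?d * ?c1 = - ?d * ?c + (- 2 * ?d * ?c1 + - (A * ?d) * int p)"
  proof -
    have A_eq: "A = 1 - int p - int r" using n npr by simp
    have "?c + 2 * ?c1 + A * int p = ?c1 + ?c2"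
      unfolding c c1 A_eq by (simp add: algebra_simps)
    then have "?d * (?c + 2 * ?c1 + A * int p) = ?d * (?c1 + ?c2)" by simp
    then show ?thesis by (simp add: algebra_simps)
  qed
  \<comment> \<open>The t-exponents match identically in \<Omega>: the power of t in the Serre
    element is the one produced by the braiding and the normalisation of divided powers.\<close>
  have t: "- int r * (int p * ?d - \<Omega> i j + \<Omega> j i) + (- ?d * ?c2 + - ?d * ?c1) =
      - ?d * ?c + int n * (\<Omega> i j - \<Omega> j i) + (\<Omega> j i - \<Omega> i j) * int p"
    unfolding c unfolding npr by (simp add: algebra_simps)
  have "tt powi (- int r * (int p * ?d - \<Omega> i j + \<Omega> j i)) *
      (inverse ((v_at \<Omega> i * t_at \<Omega> i) ^ (r choose 2)) * inverse ((v_at \<Omega> i * t_at \<Omega> i) ^ (p choose 2))) =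
      vv powi (- ?d * ?c2 + - ?d * ?c1) *
      tt powi (- int r * (int p * ?d - \<Omega> i j + \<Omega> j i) + (- ?d * ?c2 + - ?d * ?c1))"
    unfolding inv by (simp only: power_int_add vv_tt_nonzero simp_thms mult_ac)
  also have "\<dots> = vv powi (- ?d * ?c) * tt powi (- ?d * ?c + int n * (\<Omega> i j - \<Omega> j i)) *
      (q i i ^ (p choose 2) * q i j ^ p)"
    unfolding t unfolding v qii qij by (simp only: power_int_add vv_tt_nonzero simp_thms mult_ac)
  finally have pow: "tt powi (- int r * (int p * ?d - \<Omega> i j + \<Omega> j i)) *
      (inverse ((v_at \<Omega> i * t_at \<Omega> i) ^ (r choose 2)) * inverse ((v_at \<Omega> i * t_at \<Omega> i) ^ (p choose 2))) =
      vv powi (- ?d * ?c) * tt powi (- ?d * ?c + int n * (\<Omega> i j - \<Omega> j i)) *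
      (q i i ^ (p choose 2) * q i j ^ p)" .
  have sign: "(-1) ^ r = (-1) ^ n * (-1 :: qvt) ^ p"
    unfolding npr by (simp add: power_add mult_ac flip: power_mult_distrib)
  have "adj_coeff i j n p = ((-1) ^ p * qfac i n * q i i ^ (p choose 2) * q i j ^ p) /
      (qfac i p * qfac i (n - p))"
    using adj_coeff_eq[OF p, of i j] qfac_nonzero by (simp add: field_simps)
  then have *: "adj_coeff i j n p / qfac i n =
      (-1) ^ p * (q i i ^ (p choose 2) * q i j ^ p) * (inverse (qfac i p) * inverse (qfac i r))"
    using qfac_nonzero by (simp add: field_simps r_def)
  have "(-1) ^ r * tt powi (- int r * (int p * ?d - \<Omega> i j + \<Omega> j i)) *
      (inverse (qfact (v_at \<Omega> i) (t_at \<Omega> i) r) * inverse (qfact (v_at \<Omega> i) (t_at \<Omega> i) p)) =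
     (-1) ^ r * (tt powi (- int r * (int p * ?d - \<Omega> i j + \<Omega> j i)) *
      (inverse ((v_at \<Omega> i * t_at \<Omega> i) ^ (r choose 2)) * inverse ((v_at \<Omega> i * t_at \<Omega> i) ^ (p choose 2)))) *
      (inverse (qfac i p) * inverse (qfac i r))"
    unfolding qfact_eq inverse_mult_distrib by (simp only: mult_ac)
  also have "\<dots> = (-1) ^ n * vv powi (- ?d * ?c) * tt powi (- ?d * ?c + int n * (\<Omega> i j - \<Omega> j i)) *
      (adj_coeff i j n p / qfac i n)"
    unfolding pow sign * by (simp only: mult_ac)
  finally show ?thesis unfolding r_def by simp
qed

lemma serre_eq_adj:
  assumes A: "\<Omega> i j + \<Omega> j i = A * \<Omega> i i" and n: "int n = 1 - A"
  shows "\<exists>c. c \<noteq> 0 \<and> serre \<Omega> i j = scal c ((adj i ^^ n) (theta j))"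
proof -
  define c where "c = (-1) ^ n * vv powi (- \<Omega> i i * int (n choose 2)) *
      tt powi (- \<Omega> i i * int (n choose 2) + int n * (\<Omega> i j - \<Omega> j i)) / qfac i n"
  have "(2 * dot \<Omega> (simple i) (simple j)) div dot \<Omega> (simple i) (simple i) = A"
    using A pos[of i] by (simp add: dot_def ang_def bilin_simple)
  then have range: "1 - (2 * dot \<Omega> (simple i) (simple j)) div dot \<Omega> (simple i) (simple i) = int n"
    using n by simp
  \<comment> \<open>Indexed by the right-hand power, as in \<open>adj_funpow_theta\<close>.\<close>
  have P: "{(p, p'). int p + int p' = int n} = (\<lambda>p. (n - p, p)) ` {..n}"
    by (auto simp: image_iff)
  have inj: "inj_on (\<lambda>p. (n - p, p)) {..n}"
    by (auto simp: inj_on_def)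
  have "serre \<Omega> i j = (\<Sum>p\<le>n. scal ((-1) ^ (n - p) *
      tt powi (- int (n - p) * (int p * \<Omega> i i - \<Omega> i j + \<Omega> j i)))
          (divpow \<Omega> i (n - p) * theta j * divpow \<Omega> i p))"
    unfolding serre_def range P sum.reindex[OF inj]
    by (simp add: dot_def ang_def bilin_simple algebra_simps)
  also have "\<dots> = (\<Sum>p\<le>n. scal (c * adj_coeff i j n p) (theta i ^ (n - p) * theta j * theta i ^ p))"
  proof (rule sum.cong)
    fix p assume "p \<in> {..n}"
    then show "scal ((-1) ^ (n - p) * tt powi (- int (n - p) * (int p * \<Omega> i i - \<Omega> i j + \<Omega> j i)))
          (divpow \<Omega> i (n - p) * theta j * divpow \<Omega> i p) =
       scal (c * adj_coeff i j n p) (theta i ^ (n - p) * theta j * theta i ^ p)"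
      unfolding c_def by (subst serre_coeff[OF A n, symmetric]) (simp_all add: divpow_def mult_ac)
  qed simp
  also have "\<dots> = scal c ((adj i ^^ n) (theta j))"
    by (simp add: adj_funpow_theta scal_sum)
  finally have "serre \<Omega> i j = scal c ((adj i ^^ n) (theta j))" .
  moreover have "c \<noteq> 0" by (simp add: c_def qfac_nonzero)
  ultimately show ?thesis by blast
qed

lemma wdiag_chi_adj_funpow:
  "\<exists>c. wdiag (chi \<alpha>) ((adj i ^^ n) (theta j)) = scal c ((adj i ^^ n) (theta j))"
  "\<exists>c. wdiag (\<lambda>\<beta>. chi \<beta> \<alpha>) ((adj i ^^ n) (theta j)) = scal c ((adj i ^^ n) (theta j))"
  by (induction n) (auto simp: wdiag_chi_adj)

text \<open>For k = i the lowering constant vanishes: with h = \<open>q i j * q j i\<close>, which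
  is the A-th power of \<open>q i i\<close>, the choice n = 1 - A gives q^n h = q. For k \<noteq> i
  the derivation reaches \<open>theta j\<close> and leaves a multiple of 1, which
  \<open>adj i\<close> kills as n > 0.\<close>

lemma lder_adj_funpow_theta:
  assumes "i \<noteq> j" and A: "\<Omega> i j + \<Omega> j i = A * \<Omega> i i" and n: "int n = 1 - A" "n > 0"
  shows "lder k ((adj i ^^ n) (theta j)) = 0"
proof (cases "k = i")
  case True
  let ?h = "q i j * q j i"
  have h: "?h = vv powi (- 2 * A * \<Omega> i i)"
    using A unfolding chi_swap by (simp add: dot_def ang_def bilin_simple mult.assoc)
  have "q i i ^ n * ?h = vv powi (- 2 * \<Omega> i i * int n + - 2 * A * \<Omega> i i)"
    unfolding h q_self_power by (subst power_int_add) simp_all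
  also have "- 2 * \<Omega> i i * int n + - 2 * A * \<Omega> i i = - 2 * \<Omega> i i"
    unfolding n by (simp add: algebra_simps)
  finally have "q i i ^ n * ?h = q i i" unfolding q_self .
  then have "q i i * ((1 - q i i) * ladder i ?h n) = 0"
    unfolding ladder_eq by simp
  moreover have "q i i \<noteq> 1" using q_self_power_eq_one[of i 1] by simp
  ultimately have "ladder i ?h n = 0" by simp
  moreover have "sig i (tau i (theta j)) = scal ?h (theta j)" by simp
  ultimately show ?thesis
    using assms(1) unfolding True by (simp add: lder_adj_funpow adj_funpow_linear)
next
  case False
  have "lder k ((adj i ^^ m) (theta j)) = scal (q i k ^ m) ((adj i ^^ m) (lder k (theta j)))" for m
    by (induction m) (simp_all add: lder_adj_other[OF False])
  moreover have "(adj i ^^ n) 1 = 0"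
    using n(2) by (cases n) (simp_all add: funpow_swap1 adj_funpow_linear)
  ultimately show ?thesis by (simp add: adj_funpow_linear)
qed

lemma adj_funpow_theta_rad:
  assumes "i \<noteq> j" "\<Omega> i j + \<Omega> j i = A * \<Omega> i i" "int n = 1 - A" "n > 0"
  shows "(adj i ^^ n) (theta j) \<in> rad"
proof (rule mem_radI)
  show "eps ((adj i ^^ n) (theta j)) = 0"
    by (cases n) (simp_all add: adj_def)
qed (use lder_adj_funpow_theta[OF assms] in simp)

end

theorem corollary2:
  fixes \<Omega> :: "'i::finite \<Rightarrow> 'i \<Rightarrow> int"
  assumes "\<And>i. \<Omega> i i > 0"
    and "\<And>i j. i \<noteq> j \<Longrightarrow> \<Omega> i j \<le> 0"
    and "\<And>i j. i \<noteq> j \<Longrightarrow> rat_of_int (\<Omega> i j + \<Omega> j i) / rat_of_int (\<Omega> i i) \<in> \<int>\<^sub>\<le>\<^sub>0"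
    and "Gcd (range (\<lambda>i. \<Omega> i i)) = 1"
  shows "form_radical (the_form \<Omega>) = two_sided_ideal hull {serre \<Omega> i j | i j. i \<noteq> j}"
proof -
  interpret cartan_form \<Omega>
    by unfold_locales (rule assms(1))
  define J where "J = two_sided_ideal hull {serre \<Omega> i j | i j. i \<noteq> j}"
  have ideal: "two_sided_ideal J"
    unfolding J_def by (rule two_sided_ideal_hull)
  have J_scal: "scal c x \<in> J" if "x \<in> J" for c x
    using ideal that by (simp add: two_sided_ideal_def scal_eq_mult)
  have serre: "\<exists>n c. c \<noteq> 0 \<and> serre \<Omega> i j = scal c ((adj i ^^ n) (theta j)) \<and>
      (adj i ^^ n) (theta j) \<in> rad \<and> (\<forall>k. lder k ((adj i ^^ n) (theta j)) = 0)" if ij: "i \<noteq> j" for i j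
  proof -
    \<comment> \<open>A is the Cartan integer 2 (i \<cdot> j)/(i \<cdot> i).\<close>
    obtain A where "A \<le> 0" and "rat_of_int (\<Omega> i j + \<Omega> j i) / rat_of_int (\<Omega> i i) = rat_of_int A"
      using assms(3)[OF ij] by (auto simp: nonpos_Ints_def)
    then have "rat_of_int (\<Omega> i j + \<Omega> j i) = rat_of_int (A * \<Omega> i i)"
      using assms(1)[of i] by (simp add: field_simps)
    then have A: "\<Omega> i j + \<Omega> j i = A * \<Omega> i i" by (simp only: of_int_eq_iff)
    have n: "int (nat (1 - A)) = 1 - A" "nat (1 - A) > 0" using \<open>A \<le> 0\<close> by simp_all
    show ?thesis
      using serre_eq_adj[OF A n(1)] adj_funpow_theta_rad[OF ij A n] lder_adj_funpow_theta[OF ij A n]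
      by blast
  qed
  have serre_J: "serre \<Omega> i j \<in> J" if "i \<noteq> j" for i j
    unfolding J_def using that by (intro hull_inc) blast
  have "J \<subseteq> rad"
    unfolding J_def
  proof (rule hull_minimal)
    show "{serre \<Omega> i j | i j. i \<noteq> j} \<subseteq> rad"
      using serre by fastforce
  qed (rule two_sided_ideal_rad)
  \<comment> \<open>Closure of the hull under the operators follows by minimality, since
    \<open>?K\<close> is itself an ideal containing the generators. \<open>sig\<close> is included
    because the skew Leibniz rule for \<open>lder\<close> involves it.\<close>
  moreover have "J \<subseteq> {x \<in> J. \<forall>k. tau k x \<in> J \<and> sig k x \<in> J \<and> lder k x \<in> J}" (is "_ \<subseteq> ?K")
    unfolding J_def
  proof (rule hull_minimal, fold J_def)
    show "{serre \<Omega> i j | i j. i \<noteq> j} \<subseteq> ?K"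
    proof clarify
      fix i j :: 'i assume "i \<noteq> j"
      then obtain n c where c: "c \<noteq> 0" "serre \<Omega> i j = scal c ((adj i ^^ n) (theta j))"
        and lder: "\<And>k. lder k ((adj i ^^ n) (theta j)) = 0" using serre by blast
      have sJ: "serre \<Omega> i j \<in> J" using \<open>i \<noteq> j\<close> by (rule serre_J)
      have "\<exists>d. tau k (serre \<Omega> i j) = scal d (serre \<Omega> i j)" "\<exists>d. sig k (serre \<Omega> i j) = scal d (serre \<Omega> i j)" for k
        using wdiag_chi_adj_funpow[where \<alpha> = "simple k" and i = i and n = n and j = j] unfolding c(2) by (auto simp: mult.commute)
      then have "tau k (serre \<Omega> i j) \<in> J" "sig k (serre \<Omega> i j) \<in> J" for k
        by (metis J_scal sJ)+
      moreover have "lder k (serre \<Omega> i j) \<in> J" for k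
        using ideal by (simp add: c(2) lder two_sided_ideal_def)
      ultimately show "serre \<Omega> i j \<in> J \<and> (\<forall>k. tau k (serre \<Omega> i j) \<in> J \<and> sig k (serre \<Omega> i j) \<in> J \<and>
          lder k (serre \<Omega> i j) \<in> J)" using sJ by blast
    qed
    show "two_sided_ideal ?K"
      using ideal by (simp add: two_sided_ideal_def wdiag_chi_mult lder_mult)
  qed
  moreover have "\<exists>N. (adj i ^^ N) (theta j) \<in> J" if ij: "i \<noteq> j" for i j
  proof -
    obtain n c where c: "c \<noteq> 0" "serre \<Omega> i j = scal c ((adj i ^^ n) (theta j))"
      using serre[OF ij] by blast
    then have "(adj i ^^ n) (theta j) = scal (inverse c) (serre \<Omega> i j)" by simp
    then show ?thesis using J_scal[OF serre_J[OF ij]] by metis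
  qed
  ultimately interpret serre_ideal \<Omega> J
    using ideal by unfold_locales auto
  show ?thesis
    unfolding form_radical_eq_rad J_def[symmetric] using rad_subset \<open>J \<subseteq> rad\<close> by blast
qed

end
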